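(* Let $0<b<a$, $T>0$, let $\gamma_1,\gamma_2>0$ be constants with $\gamma_1\neq\gamma_2$, and let $\gamma(x)=\gamma_1$ for $0<x<b$, $\gamma(x)=\gamma_2$ for $b<x<a$. Let $u=u(x,t)$ be an arbitrary solution (in the sense given in the context) of $$u_t=(\gamma u_x)_x\ \text{ in } ]0,a[\,\times\,]0,T[,\qquad u(x,0)=0\ \text{ in } ]0,a[ .$$ Let $M>0$ satisfy $M\ge 2b/\sqrt{\gamma_1}$ and let $c$ be an arbitrary positive number satisfying $Mc<T$. For $\tau>c^{-2}$ let $z=-c\tau\bigl(1+i\sqrt{1-\tfrac{1}{c^2\tau}}\bigr)$, let $$w'(0)=\int_0^T e^{-z^2t}u_x(0,t)\,dt,\qquad w'(a)=\int_0^T e^{-z^2t}u_x(a,t)\,dt$$ (these depend on $\tau$), and let $I_c(\tau)$ be the indicator function defined in the context. Assume that $$\lim_{\tau\to\infty}\left|\frac{w'(a)}{w'(0)}\right|\exp\left(c\,\tau\Bigl(\frac{b}{\sqrt{\gamma_1}}-\frac{a-b}{\sqrt{\gamma_2}}\Bigr)\right)=0$$ and that there exist a positive constant $C$, a positive number $\tau_0$ and a real number $\mu$ such that, for all $\tau>\tau_0$, $$C\,\tau^{\mu}\le |w'(0)| .$$ Then $$\lim_{\tau\to\infty}\frac{\log|I_c(\tau)|}{\tau}=-2\,\frac{c\,b}{\sqrt{\gamma_1}} .$$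
   Context: Solutions are understood in a variational sense: $u\in L^2(0,T;H^1(]0,a[))$ with $u_t\in L^2(0,T;(H^1(]0,a[))')$, with boundary derivatives $u_x(0,t),u_x(a,t)\in L^2(0,T)$, and $u$ satisfies the equation weakly, i.e. for all $\varphi\in H^1(]0,a[)$ and a.e. $t\in\,]0,T[$, $\langle u_t,\varphi\rangle+\int_0^a\gamma u_x\varphi'\,dx=\gamma_2u_x(a,t)\varphi(a)-\gamma_1u_x(0,t)\varphi(0)$, with $u(\cdot,0)=0$. No boundary condition at $x=a$ is specified. Indicator function: with $z_1=z/\sqrt{\gamma_1}$ put $v(x,t)=e^{-z^2t}e^{xz_1}$ (a solution of $v_t+\gamma_1v_{xx}=0$), and for $\tau>c^{-2}$ $$I_c(\tau)=\int_0^T\bigl(-\gamma_1v_x(0,t)u(0,t)+\gamma_1u_x(0,t)v(0,t)\bigr)\,dt .$$ *)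

theory Defs
  imports "HOL-Analysis.Analysis"
begin

text \<open>Real Sobolev and Bochner spaces on the intervals \<open>]0,l[\<close>. Elements are represented by functions
  on the whole line; only their restriction to the interval matters.\<close>

definition L2 :: "real \<Rightarrow> (real \<Rightarrow> real) set" where
  "L2 l = {f. f \<in> borel_measurable (lebesgue_on {0<..<l}) \<and>
              integrable (lebesgue_on {0<..<l}) (\<lambda>x. (f x)\<^sup>2)}"

definition L2_norm :: "real \<Rightarrow> (real \<Rightarrow> real) \<Rightarrow> real" where
  "L2_norm l f = sqrt (LINT x|lebesgue_on {0<..<l}. (f x)\<^sup>2)"

text \<open>\<open>\<phi>\<close> belongs to \<open>C\<^sub>c\<^sup>1(]0,l[)\<close> and has derivative \<open>\<phi>'\<close>.\<close>

definition test_function :: "real \<Rightarrow> (real \<Rightarrow> real) \<Rightarrow> (real \<Rightarrow> real) \<Rightarrow> bool" where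
  "test_function l \<phi> \<phi>' \<longleftrightarrow>
     (\<forall>x. (\<phi> has_real_derivative \<phi>' x) (at x)) \<and> continuous_on UNIV \<phi>' \<and>
     (\<exists>K. compact K \<and> K \<subseteq> {0<..<l} \<and> (\<forall>x. x \<notin> K \<longrightarrow> \<phi> x = 0))"

definition weak_deriv :: "real \<Rightarrow> (real \<Rightarrow> real) \<Rightarrow> (real \<Rightarrow> real) \<Rightarrow> bool" where
  "weak_deriv l f g \<longleftrightarrow>
     (\<forall>\<phi> \<phi>'. test_function l \<phi> \<phi>' \<longrightarrow>
        (LINT x|lebesgue_on {0<..<l}. f x * \<phi>' x) = - (LINT x|lebesgue_on {0<..<l}. g x * \<phi> x))"

text \<open>The weak derivative of an \<open>H\<^sup>1\<close> function; it is determined almost everywhere.\<close>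

definition wd :: "real \<Rightarrow> (real \<Rightarrow> real) \<Rightarrow> real \<Rightarrow> real" where
  "wd l f = (SOME g. g \<in> L2 l \<and> weak_deriv l f g)"

text \<open>An element of \<open>H\<^sup>1(]0,l[)\<close> is represented by its continuous version on \<open>[0,l]\<close>, so that the
  traces at the end points are the values of the function at \<open>0\<close> and \<open>l\<close>.\<close>

definition H1 :: "real \<Rightarrow> (real \<Rightarrow> real) set" where
  "H1 l = {f \<in> L2 l. continuous_on {0..l} f \<and> (\<exists>g \<in> L2 l. weak_deriv l f g)}"

definition H1_norm :: "real \<Rightarrow> (real \<Rightarrow> real) \<Rightarrow> real" where
  "H1_norm l f = sqrt ((L2_norm l f)\<^sup>2 + (L2_norm l (wd l f))\<^sup>2)"

definition H1_dual :: "real \<Rightarrow> ((real \<Rightarrow> real) \<Rightarrow> real) set" where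
  "H1_dual l = {F.
     (\<forall>\<phi>\<in>H1 l. \<forall>\<psi>\<in>H1 l. F (\<lambda>x. \<phi> x + \<psi> x) = F \<phi> + F \<psi>) \<and>
     (\<forall>k. \<forall>\<phi>\<in>H1 l. F (\<lambda>x. k * \<phi> x) = k * F \<phi>) \<and>
     (\<exists>C. \<forall>\<phi>\<in>H1 l. \<bar>F \<phi>\<bar> \<le> C * H1_norm l \<phi>)}"

definition H1_dual_norm :: "real \<Rightarrow> ((real \<Rightarrow> real) \<Rightarrow> real) \<Rightarrow> real" where
  "H1_dual_norm l F = (SUP \<phi>\<in>{\<phi> \<in> H1 l. H1_norm l \<phi> \<le> 1}. \<bar>F \<phi>\<bar>)"

text \<open>The Bochner space \<open>L\<^sup>2(0,T;X)\<close>, where \<open>X\<close> is a space of real-valued functions on a type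
  \<open>'b\<close> with (semi)norm \<open>N\<close>: strongly measurable, square integrable functions \<open>f\<close> with
  \<open>f t \<in> X\<close> for almost every \<open>t\<close>. It is used for \<open>X = H\<^sup>1\<close> and for its dual.\<close>

definition strongly_measurable ::
    "real \<Rightarrow> ('b \<Rightarrow> real) set \<Rightarrow> (('b \<Rightarrow> real) \<Rightarrow> real) \<Rightarrow> (real \<Rightarrow> 'b \<Rightarrow> real) \<Rightarrow> bool" where
  "strongly_measurable T X N f \<longleftrightarrow>
     (\<exists>s. (\<forall>n::nat. simple_function (lebesgue_on {0<..<T}) (s n) \<and> (\<forall>t. s n t \<in> X)) \<and>
          (AE t in lebesgue_on {0<..<T}. (\<lambda>n. N (\<lambda>y. s n t y - f t y)) \<longlonglongrightarrow> 0))"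

definition L2_Bochner ::
    "real \<Rightarrow> ('b \<Rightarrow> real) set \<Rightarrow> (('b \<Rightarrow> real) \<Rightarrow> real) \<Rightarrow> (real \<Rightarrow> 'b \<Rightarrow> real) set" where
  "L2_Bochner T X N = {f. (AE t in lebesgue_on {0<..<T}. f t \<in> X) \<and> strongly_measurable T X N f \<and>
                          integrable (lebesgue_on {0<..<T}) (\<lambda>t. (N (f t))\<^sup>2)}"

text \<open>\<open>F = u\<^sub>t\<close> in the sense of distributions on \<open>]0,T[\<close> with values in the dual of \<open>H\<^sup>1(]0,a[)\<close>,
  where \<open>L\<^sup>2(]0,a[)\<close> is embedded in the dual by the \<open>L\<^sup>2\<close> pairing. The dual-valued identity
  is evaluated at each \<open>\<phi>\<close>.\<close>

definition time_deriv ::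
    "real \<Rightarrow> real \<Rightarrow> (real \<Rightarrow> real \<Rightarrow> real) \<Rightarrow> (real \<Rightarrow> (real \<Rightarrow> real) \<Rightarrow> real) \<Rightarrow> bool" where
  "time_deriv a T u F \<longleftrightarrow>
     (\<forall>\<phi>\<in>H1 a. weak_deriv T (\<lambda>t. LINT x|lebesgue_on {0<..<a}. u t x * \<phi> x) (\<lambda>t. F t \<phi>))"

text \<open>\<open>u(\<cdot>,0) = 0\<close>: the version of \<open>u\<close> in \<open>C([0,T];L\<^sup>2(]0,a[))\<close> vanishes at time \<open>0\<close>.\<close>

definition zero_initial_value :: "real \<Rightarrow> real \<Rightarrow> (real \<Rightarrow> real \<Rightarrow> real) \<Rightarrow> bool" where
  "zero_initial_value a T u \<longleftrightarrow>
     (\<exists>U. (\<forall>t\<in>{0..T}. U t \<in> L2 a) \<and>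
          (\<forall>s\<in>{0..T}. ((\<lambda>t. L2_norm a (\<lambda>x. U t x - U s x)) \<longlongrightarrow> 0) (at s within {0..T})) \<and>
          (AE t in lebesgue_on {0<..<T}. AE x in lebesgue_on {0<..<a}. U t x = u t x) \<and>
          (AE x in lebesgue_on {0<..<a}. U 0 x = 0))"

definition conductivity :: "real \<Rightarrow> real \<Rightarrow> real \<Rightarrow> real \<Rightarrow> real" where
  "conductivity b \<gamma>\<^sub>1 \<gamma>\<^sub>2 x = (if x < b then \<gamma>\<^sub>1 else \<gamma>\<^sub>2)"

text \<open>\<open>u t x\<close> stands for \<open>u(x,t)\<close>. The functions \<open>u\<^sub>x\<^sub>0\<close> and \<open>u\<^sub>x\<^sub>a\<close> are the boundary derivatives
  \<open>u\<^sub>x(0,\<cdot>)\<close> and \<open>u\<^sub>x(a,\<cdot>)\<close>. An element of \<open>L\<^sup>2(0,T;H\<^sup>1)\<close> need not have traces of \<open>u\<^sub>x\<close>; they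
  have their meaning through the weak equation, which determines them almost everywhere since
  \<open>\<phi>(0)\<close> and \<open>\<phi>(a)\<close> are arbitrary.\<close>

definition heat_solution ::
    "real \<Rightarrow> real \<Rightarrow> real \<Rightarrow> real \<Rightarrow> real \<Rightarrow> (real \<Rightarrow> real \<Rightarrow> real) \<Rightarrow> (real \<Rightarrow> real) \<Rightarrow> (real \<Rightarrow> real) \<Rightarrow> bool"
  where
  "heat_solution a b \<gamma>\<^sub>1 \<gamma>\<^sub>2 T u u\<^sub>x\<^sub>0 u\<^sub>x\<^sub>a \<longleftrightarrow>
     u \<in> L2_Bochner T (H1 a) (H1_norm a) \<and> u\<^sub>x\<^sub>0 \<in> L2 T \<and> u\<^sub>x\<^sub>a \<in> L2 T \<and>
     (\<exists>F \<in> L2_Bochner T (H1_dual a) (H1_dual_norm a).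
        time_deriv a T u F \<and>
        (\<forall>\<phi>\<in>H1 a. AE t in lebesgue_on {0<..<T}.
           F t \<phi> + (LINT x|lebesgue_on {0<..<a}. conductivity b \<gamma>\<^sub>1 \<gamma>\<^sub>2 x * wd a (u t) x * wd a \<phi> x)
             = \<gamma>\<^sub>2 * u\<^sub>x\<^sub>a t * \<phi> a - \<gamma>\<^sub>1 * u\<^sub>x\<^sub>0 t * \<phi> 0)) \<and>
     zero_initial_value a T u"

definition z_param :: "real \<Rightarrow> real \<Rightarrow> complex" where
  "z_param c \<tau> = - complex_of_real (c * \<tau>) * (1 + \<i> * complex_of_real (sqrt (1 - 1 / (c\<^sup>2 * \<tau>))))"

definition v_fun :: "real \<Rightarrow> complex \<Rightarrow> real \<Rightarrow> real \<Rightarrow> complex" where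
  "v_fun \<gamma>\<^sub>1 z x t =
     exp (- z\<^sup>2 * complex_of_real t) * exp (complex_of_real x * (z / complex_of_real (sqrt \<gamma>\<^sub>1)))"

text \<open>The integral \<open>\<integral>\<^sub>0\<^sup>T e\<^bsup>-z\<^sup>2t\<^esup> g(t) dt\<close>; it is \<open>w'(0)\<close> for \<open>g = u\<^sub>x(0,\<cdot>)\<close> and \<open>w'(a)\<close> for
  \<open>g = u\<^sub>x(a,\<cdot>)\<close>.\<close>

definition truncated_laplace :: "real \<Rightarrow> complex \<Rightarrow> (real \<Rightarrow> real) \<Rightarrow> complex" where
  "truncated_laplace T z g =
     (LINT t|lebesgue_on {0<..<T}. exp (- z\<^sup>2 * complex_of_real t) * complex_of_real (g t))"

definition indicator_fun ::
    "real \<Rightarrow> real \<Rightarrow> (real \<Rightarrow> real \<Rightarrow> real) \<Rightarrow> (real \<Rightarrow> real) \<Rightarrow> real \<Rightarrow> real \<Rightarrow> complex" where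
  "indicator_fun \<gamma>\<^sub>1 T u u\<^sub>x\<^sub>0 c \<tau> =
     (LINT t|lebesgue_on {0<..<T}.
        - complex_of_real \<gamma>\<^sub>1 * vector_derivative (\<lambda>x. v_fun \<gamma>\<^sub>1 (z_param c \<tau>) x t) (at 0)
            * complex_of_real (u t 0)
        + complex_of_real \<gamma>\<^sub>1 * complex_of_real (u\<^sub>x\<^sub>0 t) * v_fun \<gamma>\<^sub>1 (z_param c \<tau>) 0 t)"

end

theory Submission
  imports Defs "HOL-Real_Asymp.Real_Asymp"
begin

text \<open>
  Write \<open>z\<close> for the complex parameter, \<open>z\<^sub>j = z / sqrt \<gamma>\<^sub>j\<close>, and \<open>w(x)\<close> for the integral of
  \<open>exp (- z\<^sup>2 t) u(x,t)\<close> over \<open>]0,T[\<close>. Then \<open>Re (z\<^sup>2) = \<tau>\<close> and \<open>Re z = - c \<tau>\<close>, and \<open>w\<close> solves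
  \<open>(\<gamma> w')' - z\<^sup>2 w = exp (- z\<^sup>2 T) u(\<cdot>,T)\<close>, whose right-hand side is of size \<open>exp (- \<tau> T)\<close>.
  The indicator function is \<open>\<gamma>\<^sub>1 (w'(0) - z\<^sub>1 w(0))\<close>, so it measures how far \<open>w\<close> is from the wave
  \<open>exp (z\<^sub>1 x)\<close>, that is, the part of \<open>w\<close> reflected at the interface \<open>b\<close>.

  To compute \<open>w(0)\<close> the equation is tested with the solution \<open>\<Phi>\<close> of \<open>(\<gamma> \<Phi>')' = z\<^sup>2 \<Phi>\<close> that has
  \<open>\<Phi>'(a) = 0\<close>, so that the unknown trace \<open>w(a)\<close> does not appear. On \<open>]0,b[\<close> it is the
  combination \<open>A exp (- z\<^sub>1 (b - x)) + B exp (z\<^sub>1 (b - x))\<close>. This yields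
  \<open>(A - B exp (2 z\<^sub>1 b)) I\<^sub>c
      = - 2 \<gamma>\<^sub>1 B exp (2 z\<^sub>1 b) w'(0) + 2 \<gamma>\<^sub>2 exp (z\<^sub>2 (a - b)) exp (z\<^sub>1 b) w'(a) - R exp (z\<^sub>1 b)\<close>,
  where \<open>R\<close> comes from \<open>u(\<cdot>,T)\<close> (lemma \<open>indicator_identity\<close>). Divide by \<open>exp (2 z\<^sub>1 b) w'(0)\<close>. The
  second term then tends to \<open>0\<close> by the assumption on \<open>w'(a) / w'(0)\<close>; the third one does because
  \<open>2 c b / sqrt \<gamma>\<^sub>1 \<le> M c < T\<close> and \<open>w'(0)\<close> is bounded below by a power of \<open>\<tau>\<close>. Since \<open>A\<close> and \<open>B\<close>
  converge to \<open>(1 \<plusminus> sqrt (\<gamma>\<^sub>2 / \<gamma>\<^sub>1)) / 2\<close>, both nonzero, the quotient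
  \<open>I\<^sub>c / (exp (2 z\<^sub>1 b) w'(0))\<close> has a nonzero limit. As \<open>w'(0)\<close> lies between a power of \<open>\<tau>\<close> and a
  constant, the logarithm of \<open>I\<^sub>c\<close> is that of \<open>exp (2 z\<^sub>1 b)\<close> up to \<open>o(\<tau>)\<close>.

  The passage from the weak formulation to the identity for \<open>w\<close> rests on one formula,
  \<open>weak_deriv_integration_by_parts\<close>: for a continuous function with an integrable weak derivative,
  integration by parts against \<open>C\<^sup>1\<close> functions holds with boundary terms. It is used in space, against
  the flux \<open>\<gamma> \<Phi>'\<close>, which is \<open>C\<^sup>1\<close> across the interface, and in time, against \<open>exp (- z\<^sup>2 t)\<close>. It also
  gives the trace inequality \<open>trace_bound\<close>, hence the measurability of the traces in time.
\<close>

section \<open>Integration over a bounded interval\<close>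

text \<open>Lebesgue measure on \<open>]0,l[\<close>.\<close>

abbreviation leb :: "real \<Rightarrow> real measure" where
  "leb l \<equiv> lebesgue_on {0<..<l}"

lemma finite_measure_leb: "finite_measure (leb l)"
  by (intro finite_measure_lebesgue_on bounded_set_imp_lmeasurable) auto

lemma measurable_leb_continuous:
  assumes "continuous_on {0..l} f"
  shows "f \<in> borel_measurable (leb l)"
  by (rule continuous_imp_measurable_on_sets_lebesgue)
     (auto intro: continuous_on_subset[OF assms])

lemma integrable_leb_continuous:
  fixes f :: "real \<Rightarrow> 'b::euclidean_space"
  assumes "continuous_on {0..l} f"
  shows "integrable (leb l) f"
proof -
  have "bounded (f ` {0..l})"
    using assms compact_continuous_image compact_imp_bounded by blast
  then obtain B where B: "\<And>x. x \<in> {0..l} \<Longrightarrow> norm (f x) \<le> B"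
    unfolding bounded_iff by blast
  show ?thesis
    using measurable_leb_continuous[OF assms] B
    by (intro finite_measure.integrable_const_bound[OF finite_measure_leb, of _ B])
       (auto simp: AE_restrict_space_iff)
qed

lemma integral_leb_eq_HK:
  fixes f :: "real \<Rightarrow> 'b::euclidean_space"
  assumes "integrable (leb l) f"
  shows "integral\<^sup>L (leb l) f = integral {0..l} f"
  using lebesgue_integral_eq_integral[OF assms] by (simp add: integral_open_interval_real)

lemma integrable_mult_bounded:
  fixes g :: "real \<Rightarrow> real" and k :: "real \<Rightarrow> 'b::{real_normed_field,euclidean_space}"
  assumes g: "integrable (leb l) g" and k: "k \<in> borel_measurable (leb l)"
    and B: "\<And>x. 0 < x \<Longrightarrow> x < l \<Longrightarrow> norm (k x) \<le> B"
  shows "integrable (leb l) (\<lambda>x. g x *\<^sub>R k x)"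
proof (rule Bochner_Integration.integrable_bound)
  show "integrable (leb l) (\<lambda>x. B * g x)" using g by simp
  show "(\<lambda>x. g x *\<^sub>R k x) \<in> borel_measurable (leb l)"
    using g k by simp
  show "AE x in leb l. norm (g x *\<^sub>R k x) \<le> norm (B * g x)"
  proof (rule AE_I2)
    fix x assume "x \<in> space (leb l)"
    then have "norm (k x) \<le> B" using B by simp
    also have "B \<le> \<bar>B\<bar>" by simp
    finally have "norm (k x) \<le> \<bar>B\<bar>" .
    then show "norm (g x *\<^sub>R k x) \<le> norm (B * g x)"
      by (simp add: abs_mult mult_left_mono mult.commute[of _ "\<bar>g x\<bar>"])
  qed
qed

lemma continuous_Icc_bound:
  fixes k :: "real \<Rightarrow> 'b::real_normed_vector"
  assumes "continuous_on {0..l} k"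
  obtains B where "0 < B" "\<And>x. 0 \<le> x \<Longrightarrow> x \<le> l \<Longrightarrow> norm (k x) \<le> B"
proof -
  have "bounded (k ` {0..l})"
    using assms compact_continuous_image compact_imp_bounded by blast
  then obtain B where "0 < B" "\<And>x. x \<in> {0..l} \<Longrightarrow> norm (k x) \<le> B"
    by (auto simp: bounded_pos)
  then show ?thesis using that by auto
qed

lemma integrable_scaleR_continuous:
  fixes g :: "real \<Rightarrow> real" and k :: "real \<Rightarrow> 'b::{real_normed_field,euclidean_space}"
  assumes g: "integrable (leb l) g" and k: "continuous_on {0..l} k"
  shows "integrable (leb l) (\<lambda>x. g x *\<^sub>R k x)"
proof -
  obtain B where "\<And>x. 0 \<le> x \<Longrightarrow> x \<le> l \<Longrightarrow> norm (k x) \<le> B"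
    using continuous_Icc_bound[OF k] by blast
  then show ?thesis
    by (intro integrable_mult_bounded[where B = B] g measurable_leb_continuous k) auto
qed

lemma integrable_mult_continuous:
  fixes g k :: "real \<Rightarrow> real"
  assumes g: "integrable (leb l) g" and k: "continuous_on {0..l} k"
  shows "integrable (leb l) (\<lambda>x. g x * k x)"
  using integrable_scaleR_continuous[OF assms] by simp

lemma L2_integrable:
  assumes "f \<in> L2 l" shows "integrable (leb l) f"
proof (rule Bochner_Integration.integrable_bound)
  show "integrable (leb l) (\<lambda>x. 1 + (f x)\<^sup>2)"
    using assms by (auto simp: L2_def intro!: finite_measure.integrable_const finite_measure_leb)
  have "\<bar>y\<bar> \<le> 1 + y\<^sup>2" for y :: real
  proof -
    have "0 \<le> (\<bar>y\<bar> - 1)\<^sup>2" by simp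
    then have "2 * \<bar>y\<bar> \<le> 1 + y\<^sup>2" by (simp add: power2_diff)
    then show ?thesis by linarith
  qed
  then show "AE x in leb l. norm (f x) \<le> norm (1 + (f x)\<^sup>2)" by simp
qed (use assms in \<open>auto simp: L2_def\<close>)

lemma L1_le_L2_norm:
  assumes f: "f \<in> L2 l" and l: "0 < l"
  shows "(LINT x|leb l. \<bar>f x\<bar>) \<le> sqrt l * L2_norm l f"
proof -
  define A where "A = (LINT x|leb l. \<bar>f x\<bar>)"
  define m where "m = A / l"
  have int: "integrable (leb l) (\<lambda>x. (f x)\<^sup>2)" "integrable (leb l) (\<lambda>x. \<bar>f x\<bar>)"
    "integrable (leb l) (\<lambda>x. m\<^sup>2)"
    using f L2_integrable[OF f]
    by (auto simp: L2_def intro!: finite_measure.integrable_const finite_measure_leb)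
  \<comment> \<open>The variance of \<open>\<bar>f\<bar>\<close> about its mean \<open>m\<close> is nonnegative.\<close>
  have "0 \<le> (LINT x|leb l. (\<bar>f x\<bar> - m)\<^sup>2)" by simp
  also have "\<dots> = (LINT x|leb l. (f x)\<^sup>2 - 2 * m * \<bar>f x\<bar> + m\<^sup>2)"
    by (intro Bochner_Integration.integral_cong) (auto simp: power2_diff)
  also have "\<dots> = (LINT x|leb l. (f x)\<^sup>2) - 2 * m * A + m\<^sup>2 * l"
    using int l by (simp add: A_def measure_restrict_space)
  also have "\<dots> = (LINT x|leb l. (f x)\<^sup>2) - A\<^sup>2 / l"
    using l by (simp add: m_def field_simps power2_eq_square)
  finally have "A\<^sup>2 \<le> l * (LINT x|leb l. (f x)\<^sup>2)"
    using l by (simp add: field_simps)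
  then have "\<bar>A\<bar> \<le> sqrt (l * (LINT x|leb l. (f x)\<^sup>2))"
    using real_sqrt_le_mono by fastforce
  then show ?thesis by (simp add: A_def L2_norm_def real_sqrt_mult)
qed

section \<open>Integration by parts up to the boundary for weak derivatives\<close>

text \<open>A \<open>C\<^sup>1\<close> function that increases from \<open>0\<close> to \<open>1\<close> on \<open>[0,1]\<close> and is constant on either side:
  a quadratic spline with knots \<open>0\<close>, \<open>1/2\<close> and \<open>1\<close>.\<close>

definition ramp :: "real \<Rightarrow> real" where
  "ramp y = 2 * (max 0 y)\<^sup>2 - 4 * (max 0 (y - 1/2))\<^sup>2 + 2 * (max 0 (y - 1))\<^sup>2"

text \<open>The derivative of \<open>ramp\<close>.\<close>

definition tent :: "real \<Rightarrow> real" where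
  "tent y = 4 * max 0 y - 8 * max 0 (y - 1/2) + 4 * max 0 (y - 1)"

lemma DERIV_max_0_squared: "((\<lambda>y::real. (max 0 y)\<^sup>2) has_real_derivative 2 * max 0 y) (at y)"
proof -
  consider "y < 0" | "0 < y" | "y = 0" by linarith
  then show ?thesis
  proof cases
    case 1
    have "((\<lambda>y::real. 0) has_real_derivative 0) (at y)" by simp
    then have "((\<lambda>y::real. (max 0 y)\<^sup>2) has_real_derivative 0) (at y)"
      by (rule has_field_derivative_transform_within_open[of _ _ _ "{..<0}"]) (use 1 in auto)
    then show ?thesis using 1 by simp
  next
    case 2
    have "((\<lambda>y::real. y\<^sup>2) has_real_derivative 2 * y) (at y)"
      by (auto intro!: derivative_eq_intros)
    then have "((\<lambda>y::real. (max 0 y)\<^sup>2) has_real_derivative 2 * y) (at y)"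
      by (rule has_field_derivative_transform_within_open[of _ _ _ "{0<..}"]) (use 2 in auto)
    then show ?thesis using 2 by simp
  next
    case 3
    have "((\<lambda>h::real. (max 0 h)\<^sup>2 / h) \<longlongrightarrow> 0) (at 0)"
    proof (rule Lim_null_comparison)
      show "\<forall>\<^sub>F h in at (0::real). norm ((max 0 h)\<^sup>2 / h) \<le> \<bar>h\<bar>"
        by (rule always_eventually) (auto simp: max_def power2_eq_square)
      show "((\<lambda>h::real. \<bar>h\<bar>) \<longlongrightarrow> 0) (at 0)" using tendsto_rabs_zero[OF tendsto_ident_at] by simp
    qed
    then show ?thesis using 3 by (simp add: DERIV_def)
  qed
qed

lemma DERIV_ramp: "(ramp has_real_derivative tent y) (at y)"
  unfolding ramp_def[abs_def] tent_def
  by (rule derivative_eq_intros DERIV_max_0_squared DERIV_chain2[OF DERIV_max_0_squared] refl | simp)+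

lemma continuous_tent: "continuous_on UNIV tent"
  unfolding tent_def[abs_def] by (intro continuous_intros)

lemma ramp_eq_0: "y \<le> 0 \<Longrightarrow> ramp y = 0"
  by (simp add: ramp_def)

lemma ramp_eq_1: "1 \<le> y \<Longrightarrow> ramp y = 1"
  by (simp add: ramp_def power2_eq_square field_simps)

lemma tent_eq_0: "y \<le> 0 \<or> 1 \<le> y \<Longrightarrow> tent y = 0"
  by (auto simp: tent_def)

lemma tent_nonneg: "0 \<le> tent y"
  by (auto simp: tent_def max_def)

lemma ramp_mono: "x \<le> y \<Longrightarrow> ramp x \<le> ramp y"
  using DERIV_nonneg_imp_nondecreasing[of x y ramp] DERIV_ramp tent_nonneg by blast

lemma ramp_bounds: "0 \<le> ramp y" "ramp y \<le> 1"
  using ramp_mono[of "min 0 y" y] ramp_eq_0[of "min 0 y"]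
    ramp_mono[of y "max 1 y"] ramp_eq_1[of "max 1 y"] by auto

lemma DERIV_ramp_affine:
  "((\<lambda>x. ramp (c * x + d)) has_real_derivative c * tent (c * x + d)) (at x)"
proof -
  have "((\<lambda>x. c * x + d) has_real_derivative c) (at x)"
    by (auto intro!: derivative_eq_intros)
  from DERIV_chain2[OF DERIV_ramp this] show ?thesis by (simp add: mult.commute)
qed

lemma continuous_on_tent_affine [continuous_intros]: "continuous_on S (\<lambda>x. tent (c * x + d))"
  by (rule continuous_on_compose2[OF continuous_tent]) (auto intro!: continuous_intros)

lemma continuous_on_ramp_affine [continuous_intros]: "continuous_on S (\<lambda>x. ramp (c * x + d))"
  by (rule DERIV_continuous_on) (rule has_field_derivative_at_within[OF DERIV_ramp_affine])

text \<open>Nonnegative kernels of mass \<open>1\<close> that concentrate at a point \<open>p\<close> of \<open>[0,l]\<close>, possibly an end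
  point, evaluate continuous functions at \<open>p\<close>. At an end point all the mass lies on one side.\<close>

lemma integral_approximate_identity:
  fixes h :: "real \<Rightarrow> real" and \<rho> :: "nat \<Rightarrow> real \<Rightarrow> real"
  assumes h: "continuous_on {0..l} h" and p: "p \<in> {0..l}"
    and cont: "\<And>n. continuous_on {0..l} (\<rho> n)"
    and nonneg: "\<And>n x. 0 \<le> \<rho> n x"
    and one: "\<forall>\<^sub>F n in sequentially. (LINT x|leb l. \<rho> n x) = 1"
    and conc: "\<And>n x. \<rho> n x \<noteq> 0 \<Longrightarrow> \<bar>x - p\<bar> \<le> 2 / real n"
  shows "(\<lambda>n. LINT x|leb l. h x * \<rho> n x) \<longlonglongrightarrow> h p"
proof (rule LIMSEQ_I)
  fix e :: real assume e: "0 < e"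
  obtain d where d: "0 < d" and hd: "\<And>x. x \<in> {0..l} \<Longrightarrow> \<bar>x - p\<bar> < d \<Longrightarrow> \<bar>h x - h p\<bar> < e/2"
    using h p e unfolding continuous_on_iff dist_real_def by (meson half_gt_zero)
  have "(\<lambda>n. 2 / real n) \<longlonglongrightarrow> 0" by (rule lim_const_over_n)
  then have "\<forall>\<^sub>F n in sequentially. 2 / real n < d" using d by (rule order_tendstoD)
  then have "\<forall>\<^sub>F n in sequentially. norm ((LINT x|leb l. h x * \<rho> n x) - h p) < e"
    using one
  proof eventually_elim
    case (elim n)
    have i1: "integrable (leb l) (\<lambda>x. h x * \<rho> n x)"
      by (intro integrable_leb_continuous continuous_intros h cont)
    have i2: "integrable (leb l) (\<rho> n)" by (intro integrable_leb_continuous cont)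
    have i3: "integrable (leb l) (\<lambda>x. \<bar>h x - h p\<bar> * \<rho> n x)"
      by (intro integrable_leb_continuous continuous_intros h cont)
    have "(LINT x|leb l. h x * \<rho> n x) - h p = (LINT x|leb l. h x * \<rho> n x) - (LINT x|leb l. h p * \<rho> n x)"
      using elim(2) by simp
    also have "\<dots> = (LINT x|leb l. (h x - h p) * \<rho> n x)"
      using i1 i2 by (simp add: algebra_simps)
    also have "norm \<dots> \<le> (LINT x|leb l. \<bar>h x - h p\<bar> * \<rho> n x)"
      by (rule order_trans[OF integral_norm_bound]) (simp add: abs_mult nonneg)
    also have "\<dots> \<le> (LINT x|leb l. e/2 * \<rho> n x)"
    proof (rule integral_mono[OF i3])
      show "integrable (leb l) (\<lambda>x. e/2 * \<rho> n x)" using i2 by simp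
      fix x assume "x \<in> space (leb l)"
      then have x: "x \<in> {0..l}" by simp
      show "\<bar>h x - h p\<bar> * \<rho> n x \<le> e/2 * \<rho> n x"
      proof (cases "\<rho> n x = 0")
        case False
        then have "\<bar>x - p\<bar> < d" using conc[OF False] elim(1) by linarith
        with hd[OF x] nonneg[of n x] show ?thesis by (intro mult_right_mono) auto
      qed simp
    qed
    also have "\<dots> = e/2" using elim(2) by simp
    finally show ?case using e by linarith
  qed
  then show "\<exists>N. \<forall>n\<ge>N. norm ((LINT x|leb l. h x * \<rho> n x) - h p) < e"
    by (simp add: eventually_sequentially)
qed

lemma integral_leb_FTC:
  fixes F :: "real \<Rightarrow> real"
  assumes "0 \<le> l" "\<And>x. (F has_real_derivative f x) (at x)" "continuous_on {0..l} f"
  shows "(LINT x|leb l. f x) = F l - F 0"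
proof -
  have "(f has_integral F l - F 0) {0..l}"
    using assms by (intro fundamental_theorem_of_calculus)
      (auto simp: has_real_derivative_iff_has_vector_derivative[symmetric] intro: has_field_derivative_at_within)
  then show ?thesis
    using integral_leb_eq_HK[OF integrable_leb_continuous[OF assms(3)]] by (simp add: integral_unique)
qed

text \<open>The function \<open>k\<close>, cut off near the end points by \<open>\<theta> n\<close>, is an admissible test function. The
  derivative of the cutoff consists of two concentrating kernels, which produce the boundary terms.\<close>

lemma weak_deriv_integration_by_parts:
  fixes f g k k' :: "real \<Rightarrow> real"
  assumes l: "0 < l" and f: "continuous_on {0..l} f" and g: "integrable (leb l) g"
    and fg: "weak_deriv l f g"
    and k: "\<And>x. (k has_real_derivative k' x) (at x)" and k': "continuous_on UNIV k'"
  shows "(LINT x|leb l. f x * k' x) + (LINT x|leb l. g x * k x) = f l * k l - f 0 * k 0"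
proof -
  define \<theta> where "\<theta> n x = ramp (real n * x + (-1)) - ramp (real n * x + (2 - real n * l))" for n x
  define \<rho>0 where "\<rho>0 n x = real n * tent (real n * x + (-1))" for n x
  define \<rho>1 where "\<rho>1 n x = real n * tent (real n * x + (2 - real n * l))" for n x
  have kc: "continuous_on S k" for S
    by (rule DERIV_continuous_on) (rule has_field_derivative_at_within[OF k])
  have k'c: "continuous_on S k'" for S using k' continuous_on_subset by blast
  have \<theta>c: "continuous_on S (\<theta> n)" for S n
    unfolding \<theta>_def[abs_def] by (intro continuous_intros)
  have \<rho>c: "continuous_on S (\<rho>0 n)" "continuous_on S (\<rho>1 n)" for S n
    unfolding \<rho>0_def[abs_def] \<rho>1_def[abs_def] by (intro continuous_intros)+
  have \<rho>nonneg: "0 \<le> \<rho>0 n x" "0 \<le> \<rho>1 n x" for n x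
    by (auto simp: \<rho>0_def \<rho>1_def tent_nonneg)
  have D\<theta>: "(\<theta> n has_real_derivative \<rho>0 n x - \<rho>1 n x) (at x)" for n x
    unfolding \<theta>_def[abs_def] \<rho>0_def \<rho>1_def by (intro derivative_intros DERIV_ramp_affine)
  have \<theta>b: "\<bar>\<theta> n x\<bar> \<le> 1" for n x
    unfolding \<theta>_def using ramp_bounds[of "real n * x + (-1)"]
      ramp_bounds[of "real n * x + (2 - real n * l)"] by linarith
  have big: "\<forall>\<^sub>F n in sequentially. y < real n * d" if "0 < d" for y d :: real
  proof -
    have "filterlim (\<lambda>n. real n * d) at_top sequentially"
      using that by (intro filterlim_at_top_mult_tendsto_pos[OF tendsto_const] filterlim_real_sequentially)
    then show ?thesis by (simp add: filterlim_at_top_dense)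
  qed
  \<comment> \<open>For \<open>n l > 3\<close> the cutoff \<open>\<theta> n\<close> vanishes outside \<open>[1/n, l - 1/n]\<close>.\<close>
  have main: "\<forall>\<^sub>F n in sequentially. (LINT x|leb l. f x * k' x * \<theta> n x) + (LINT x|leb l. g x * k x * \<theta> n x)
      = (LINT x|leb l. f x * k x * \<rho>1 n x) - (LINT x|leb l. f x * k x * \<rho>0 n x)"
    using big[OF l, of 3] eventually_gt_at_top[of 0]
  proof eventually_elim
    case (elim n)
    then have n: "0 < real n" by simp
    have "test_function l (\<lambda>x. k x * \<theta> n x) (\<lambda>x. k' x * \<theta> n x + k x * (\<rho>0 n x - \<rho>1 n x))"
      unfolding test_function_def
    proof (intro conjI allI exI[of _ "{1 / real n .. l - 1 / real n}"])
      show "((\<lambda>x. k x * \<theta> n x) has_real_derivative k' x * \<theta> n x + k x * (\<rho>0 n x - \<rho>1 n x)) (at x)" for x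
        by (rule DERIV_cong[OF DERIV_mult[OF k D\<theta>]]) (simp add: algebra_simps)
      show "continuous_on UNIV (\<lambda>x. k' x * \<theta> n x + k x * (\<rho>0 n x - \<rho>1 n x))"
        by (intro continuous_intros kc k'c \<theta>c \<rho>c)
      have "0 < 1 / real n" using n by simp
      then have "0 < x \<and> x < l" if "1 / real n \<le> x" "x \<le> l - 1 / real n" for x
        using that by linarith
      then show "{1 / real n .. l - 1 / real n} \<subseteq> {0<..<l}" by auto
      show "x \<notin> {1 / real n .. l - 1 / real n} \<longrightarrow> k x * \<theta> n x = 0" for x
      proof
        assume "x \<notin> {1 / real n .. l - 1 / real n}"
        then consider "x < 1 / real n" | "l - 1 / real n < x" by force
        then show "k x * \<theta> n x = 0"
        proof cases
          case 1
          then have "real n * x < 1" using n by (simp add: field_simps)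
          then show ?thesis using elim by (simp add: \<theta>_def ramp_eq_0)
        next
          case 2
          then have "real n * l - 1 < real n * x" using n by (simp add: field_simps)
          then show ?thesis using elim by (simp add: \<theta>_def ramp_eq_1)
        qed
      qed
    qed auto
    then have "(LINT x|leb l. f x * (k' x * \<theta> n x + k x * (\<rho>0 n x - \<rho>1 n x)))
        = - (LINT x|leb l. g x * (k x * \<theta> n x))"
      using fg by (simp add: weak_deriv_def)
    moreover have "(LINT x|leb l. f x * (k' x * \<theta> n x + k x * (\<rho>0 n x - \<rho>1 n x)))
      = (LINT x|leb l. f x * k' x * \<theta> n x + (f x * k x * \<rho>0 n x - f x * k x * \<rho>1 n x))"
      by (simp add: algebra_simps)
    moreover have "\<dots> = (LINT x|leb l. f x * k' x * \<theta> n x) +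
        ((LINT x|leb l. f x * k x * \<rho>0 n x) - (LINT x|leb l. f x * k x * \<rho>1 n x))"
    proof -
      have i: "integrable (leb l) (\<lambda>x. f x * k' x * \<theta> n x)"
        "integrable (leb l) (\<lambda>x. f x * k x * \<rho>0 n x)" "integrable (leb l) (\<lambda>x. f x * k x * \<rho>1 n x)"
        by (intro integrable_leb_continuous continuous_on_mult f kc k'c \<theta>c \<rho>c)+
      show ?thesis
        by (simp only: Bochner_Integration.integral_add[OF i(1) Bochner_Integration.integrable_diff[OF i(2,3)]]
            Bochner_Integration.integral_diff[OF i(2,3)])
    qed
    ultimately show ?case by (simp add: mult.assoc)
  qed
  have lim\<theta>: "(\<lambda>n. \<theta> n x) \<longlonglongrightarrow> 1" if "0 < x" "x < l" for x
  proof (rule tendsto_eventually)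
    show "\<forall>\<^sub>F n in sequentially. \<theta> n x = 1"
      using big[OF that(1), of 2] big[OF diff_gt_0_iff_gt[THEN iffD2, OF that(2)], of 2]
    proof eventually_elim
      case (elim n)
      then show ?case by (simp add: \<theta>_def ramp_eq_0 ramp_eq_1 algebra_simps)
    qed
  qed
  have DCT: "(\<lambda>n. LINT x|leb l. q x * \<theta> n x) \<longlonglongrightarrow> (LINT x|leb l. q x)"
    if q: "integrable (leb l) q" for q
  proof (rule integral_dominated_convergence[where w = "\<lambda>x. \<bar>q x\<bar>"])
    show "AE x in leb l. (\<lambda>n. q x * \<theta> n x) \<longlonglongrightarrow> q x"
      using tendsto_mult_left[OF lim\<theta>] by (intro AE_I2) fastforce
    show "AE x in leb l. norm (q x * \<theta> n x) \<le> \<bar>q x\<bar>" for n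
      using \<theta>b[of n] by (auto simp: abs_mult mult_left_le)
    show "(\<lambda>x. q x * \<theta> n x) \<in> borel_measurable (leb l)" for n
      using q measurable_leb_continuous[OF \<theta>c] by measurable
  qed (use q in auto)
  have int1: "(LINT x|leb l. \<rho>0 n x) = ramp (real n * l - 1) - ramp (-1)"
     "(LINT x|leb l. \<rho>1 n x) = ramp 2 - ramp (2 - real n * l)" for n
    using integral_leb_FTC[OF less_imp_le[OF l] DERIV_ramp_affine[of "real n" "-1"]]
      integral_leb_FTC[OF less_imp_le[OF l] DERIV_ramp_affine[of "real n" "2 - real n * l"]]
      \<rho>c[of _ n] by (simp_all add: \<rho>0_def[abs_def] \<rho>1_def[abs_def])
  have c0: "(\<lambda>n. LINT x|leb l. f x * k x * \<rho>0 n x) \<longlonglongrightarrow> f 0 * k 0"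
  proof (rule integral_approximate_identity[where h = "\<lambda>x. f x * k x" and p = 0])
    show "\<forall>\<^sub>F n in sequentially. (LINT x|leb l. \<rho>0 n x) = 1"
      using big[OF l, of 2] by eventually_elim (simp add: int1 ramp_eq_0 ramp_eq_1)
    show "\<bar>x - 0\<bar> \<le> 2 / real n" if "\<rho>0 n x \<noteq> 0" for n x
    proof -
      have "\<not> (real n * x - 1 \<le> 0 \<or> 1 \<le> real n * x - 1)" and n: "0 < real n"
        using that tent_eq_0[of "real n * x - 1"] by (auto simp: \<rho>0_def)
      then have "1 < real n * x" "real n * x < 2" by linarith+
      then have "x \<le> 2 / real n" "0 < real n * x"
        using n by (simp_all add: pos_le_divide_eq mult.commute)
      then have "x \<le> 2 / real n" "0 < x"
        using n by (simp_all add: zero_less_mult_iff)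
      then show ?thesis by simp
    qed
  qed (use l in \<open>auto intro!: continuous_on_mult f kc \<rho>c simp: \<rho>nonneg\<close>)
  have c1: "(\<lambda>n. LINT x|leb l. f x * k x * \<rho>1 n x) \<longlonglongrightarrow> f l * k l"
  proof (rule integral_approximate_identity[where h = "\<lambda>x. f x * k x" and p = l])
    show "\<forall>\<^sub>F n in sequentially. (LINT x|leb l. \<rho>1 n x) = 1"
      using big[OF l, of 2] by eventually_elim (simp add: int1 ramp_eq_0 ramp_eq_1)
    show "\<bar>x - l\<bar> \<le> 2 / real n" if "\<rho>1 n x \<noteq> 0" for n x
    proof -
      have "\<not> (real n * (x - l) + 2 \<le> 0 \<or> 1 \<le> real n * (x - l) + 2)" and n: "0 < real n"
        using that tent_eq_0[of "real n * (x - l) + 2"] by (auto simp: \<rho>1_def algebra_simps)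
      then have "- 2 < real n * (x - l)" "real n * (x - l) < 2" by linarith+
      with n have "x - l \<le> 2 / real n" "l - x \<le> 2 / real n"
        by (simp_all add: field_simps)
      then show ?thesis by (simp add: abs_le_iff)
    qed
  qed (use l in \<open>auto intro!: continuous_on_mult f kc \<rho>c simp: \<rho>nonneg\<close>)
  have "(\<lambda>n. (LINT x|leb l. f x * k' x * \<theta> n x) + (LINT x|leb l. g x * k x * \<theta> n x))
      \<longlonglongrightarrow> (LINT x|leb l. f x * k' x) + (LINT x|leb l. g x * k x)"
    by (intro tendsto_add DCT integrable_leb_continuous continuous_on_mult f k'c
        integrable_mult_continuous g kc)
  moreover have "(\<lambda>n. (LINT x|leb l. f x * k' x * \<theta> n x) + (LINT x|leb l. g x * k x * \<theta> n x))
      \<longlonglongrightarrow> f l * k l - f 0 * k 0"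
    by (rule Lim_transform_eventually[OF tendsto_diff[OF c1 c0]])
       (use main in eventually_elim, simp)
  ultimately show ?thesis by (rule LIMSEQ_unique)
qed

section \<open>Uniqueness of weak derivatives and traces of Sobolev functions\<close>

text \<open>Lebesgue measure is complete, so measurability passes to functions that agree almost
  everywhere.\<close>

lemma measurable_leb_AE:
  fixes f g :: "real \<Rightarrow> 'b::euclidean_space"
  assumes f: "f \<in> borel_measurable (leb l)" and eq: "AE x in leb l. f x = g x"
  shows "g \<in> borel_measurable (leb l)"
proof -
  have "(\<lambda>x. if x \<in> {0<..<l} then f x else 0) \<in> borel_measurable lebesgue"
    using borel_measurable_if[of "{0<..<l}" f] f by simp
  moreover have "AE x in lebesgue. (if x \<in> {0<..<l} then f x else 0) = (if x \<in> {0<..<l} then g x else 0)"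
    using eq by (auto simp: AE_restrict_space_iff)
  ultimately have "(\<lambda>x. if x \<in> {0<..<l} then g x else 0) \<in> borel_measurable lebesgue"
    by (rule borel_measurable_AE)
  then show ?thesis using borel_measurable_if[of "{0<..<l}" g] by simp
qed

text \<open>The fundamental lemma of the calculus of variations: an integrable function whose integral against
  every test function is \<open>0\<close> vanishes almost everywhere. Integration by parts extends the
  orthogonality from test functions to polynomials, Weierstrass approximation to continuous functions,
  and dominated convergence to \<open>sgn \<circ> D\<close>, which is a limit almost everywhere of continuous
  functions.\<close>

lemma fundamental_lemma_calculus_of_variations:
  fixes D :: "real \<Rightarrow> real"
  assumes l: "0 < l" and D: "integrable (leb l) D" and w: "weak_deriv l (\<lambda>x. 0) D"
  shows "AE x in leb l. D x = 0"
proof -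
  have poly: "(LINT x|leb l. D x * p x) = 0" if p: "polynomial_function p" for p :: "real \<Rightarrow> real"
  proof -
    obtain p' where p': "polynomial_function p'" "\<And>x. (p has_vector_derivative p' x) (at x)"
      using has_vector_derivative_polynomial_function[OF p] by blast
    have "(LINT x|leb l. 0 * p' x) + (LINT x|leb l. D x * p x) = 0 * p l - 0 * p 0"
      using p' by (intro weak_deriv_integration_by_parts l D w continuous_intros)
        (auto simp: has_real_derivative_iff_has_vector_derivative intro: continuous_on_polymonial_function)
    then show ?thesis by simp
  qed
  have cont: "(LINT x|leb l. D x * g x) = 0" if g: "continuous_on {0..l} g" for g :: "real \<Rightarrow> real"
  proof -
    define A where "A = (LINT x|leb l. \<bar>D x\<bar>)"
    have A: "0 \<le> A" by (simp add: A_def)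
    have bound: "\<bar>LINT x|leb l. D x * g x\<bar> \<le> e" if e: "0 < e" for e
    proof -
      define d where "d = e / (A + 1)"
      have d: "0 < d" using e A by (simp add: d_def)
      obtain p :: "real \<Rightarrow> real" where p: "polynomial_function p" "\<And>x. x \<in> {0..l} \<Longrightarrow> norm (g x - p x) < d"
        using Stone_Weierstrass_polynomial_function[OF compact_Icc g d] by blast
      have pc: "continuous_on {0..l} p" using p(1) by (rule continuous_on_polymonial_function)
      have i: "integrable (leb l) (\<lambda>x. D x * g x)" "integrable (leb l) (\<lambda>x. D x * p x)"
        by (intro integrable_mult_continuous D g pc)+
      have "(LINT x|leb l. D x * g x) = (LINT x|leb l. D x * g x - D x * p x)"
        using i poly[OF p(1)] by simp
      also have "norm \<dots> \<le> (LINT x|leb l. norm (D x * g x - D x * p x))"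
        by (rule integral_norm_bound)
      also have "\<dots> \<le> (LINT x|leb l. \<bar>D x\<bar> * d)"
      proof (rule integral_mono)
        show "integrable (leb l) (\<lambda>x. norm (D x * g x - D x * p x))" using i by simp
        show "integrable (leb l) (\<lambda>x. \<bar>D x\<bar> * d)" using D by simp
        show "norm (D x * g x - D x * p x) \<le> \<bar>D x\<bar> * d" if "x \<in> space (leb l)" for x
          using p(2)[of x] that
          by (simp add: right_diff_distrib[symmetric] abs_mult mult_left_mono)
      qed
      also have "\<dots> = A * d" by (simp add: A_def)
      also have "\<dots> \<le> (A + 1) * d" using d by (simp add: distrib_right)
      also have "\<dots> = e" using A by (simp add: d_def)
      finally show ?thesis by simp
    qed
    then show ?thesis using field_le_epsilon[of "\<bar>LINT x|leb l. D x * g x\<bar>" 0] by simp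
  qed
  have "(\<lambda>x. if x \<in> {0<..<l} then sgn (D x) else 0) \<in> borel_measurable lebesgue"
    using borel_measurable_if[of "{0<..<l}" "\<lambda>x. sgn (D x)"] D by simp
  then have "(\<lambda>x. if x \<in> {0<..<l} then sgn (D x) else 0) measurable_on UNIV"
    by (rule lebesgue_measurable_imp_measurable_on) simp
  then obtain N g where N: "negligible N" and g: "\<And>n. continuous_on UNIV (g n)"
    and lim: "\<And>x. x \<notin> N \<Longrightarrow> (\<lambda>n. g n x) \<longlonglongrightarrow> (if x \<in> {0<..<l} then sgn (D x) else 0)"
    unfolding measurable_on_def by auto
  \<comment> \<open>Truncation to \<open>[-1,1]\<close> preserves the limit \<open>sgn (D x)\<close> and provides a dominating function.\<close>
  define G where "G n x = max (-1) (min 1 (g n x))" for n x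
  have Gc: "continuous_on S (G n)" for S n
    unfolding G_def[abs_def] by (intro continuous_intros continuous_on_subset[OF g]) auto
  have "(\<lambda>n. LINT x|leb l. D x * G n x) \<longlonglongrightarrow> (LINT x|leb l. \<bar>D x\<bar>)"
  proof (rule integral_dominated_convergence[where w = "\<lambda>x. \<bar>D x\<bar>"])
    have "AE x in lebesgue. x \<notin> N"
      using N by (simp add: AE_not_in negligible_iff_null_sets)
    then have "AE x in leb l. x \<notin> N" by (auto simp: AE_restrict_space_iff)
    then show "AE x in leb l. (\<lambda>n. D x * G n x) \<longlonglongrightarrow> \<bar>D x\<bar>"
      using AE_space
    proof eventually_elim
      case (elim x)
      then have "(\<lambda>n. g n x) \<longlonglongrightarrow> sgn (D x)" using lim[of x] by simp
      then have "(\<lambda>n. D x * G n x) \<longlonglongrightarrow> D x * max (-1) (min 1 (sgn (D x)))"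
        unfolding G_def by (intro tendsto_intros)
      moreover have "D x * max (-1) (min 1 (sgn (D x))) = \<bar>D x\<bar>"
        by (simp add: sgn_real_def)
      ultimately show ?case by simp
    qed
    show "AE x in leb l. norm (D x * G n x) \<le> \<bar>D x\<bar>" for n
    proof (rule AE_I2)
      fix x
      have "\<bar>G n x\<bar> \<le> 1" by (auto simp: G_def)
      then show "norm (D x * G n x) \<le> \<bar>D x\<bar>" by (simp add: abs_mult mult_left_le)
    qed
    show "(\<lambda>x. D x * G n x) \<in> borel_measurable (leb l)" for n
      using integrable_mult_continuous[OF D Gc] by simp
  qed (use D in auto)
  then have "(LINT x|leb l. \<bar>D x\<bar>) = 0"
    by (simp add: cont[OF Gc] LIMSEQ_const_iff)
  then show ?thesis
    using integral_nonneg_eq_0_iff_AE[of "leb l" "\<lambda>x. \<bar>D x\<bar>"] D by simp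
qed

lemma test_function_continuous:
  assumes "test_function l \<phi> \<phi>'" shows "continuous_on S \<phi>" "continuous_on S \<phi>'"
  using assms unfolding test_function_def
  by (meson DERIV_continuous_on has_field_derivative_at_within, meson continuous_on_subset subset_UNIV)

lemma weak_deriv_unique:
  assumes l: "0 < l" and g: "integrable (leb l) g" "weak_deriv l f g"
    and h: "integrable (leb l) h" "weak_deriv l f h"
  shows "AE x in leb l. g x = h x"
proof -
  have "weak_deriv l (\<lambda>x. 0) (\<lambda>x. g x - h x)"
    unfolding weak_deriv_def
  proof (intro allI impI)
    fix \<phi> \<phi>' assume t: "test_function l \<phi> \<phi>'"
    have "integrable (leb l) (\<lambda>x. g x * \<phi> x)" "integrable (leb l) (\<lambda>x. h x * \<phi> x)"
      by (intro integrable_mult_continuous g h test_function_continuous[OF t])+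
    moreover have "(LINT x|leb l. g x * \<phi> x) = (LINT x|leb l. h x * \<phi> x)"
    proof -
      have "(LINT x|leb l. f x * \<phi>' x) = - (LINT x|leb l. g x * \<phi> x)"
        "(LINT x|leb l. f x * \<phi>' x) = - (LINT x|leb l. h x * \<phi> x)"
        using g(2) h(2) t unfolding weak_deriv_def by blast+
      then show ?thesis by linarith
    qed
    ultimately show "(LINT x|leb l. 0 * \<phi>' x) = - (LINT x|leb l. (g x - h x) * \<phi> x)"
      by (simp add: left_diff_distrib)
  qed
  from fundamental_lemma_calculus_of_variations[OF l _ this] show ?thesis using g h by simp
qed

lemma wd_L2: "f \<in> H1 l \<Longrightarrow> wd l f \<in> L2 l"
  and wd_weak_deriv: "f \<in> H1 l \<Longrightarrow> weak_deriv l f (wd l f)"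
proof -
  assume "f \<in> H1 l"
  then have "\<exists>g. g \<in> L2 l \<and> weak_deriv l f g" by (auto simp: H1_def)
  then have "wd l f \<in> L2 l \<and> weak_deriv l f (wd l f)" unfolding wd_def by (rule someI_ex)
  then show "wd l f \<in> L2 l" "weak_deriv l f (wd l f)" by auto
qed

lemma wd_AE_eq:
  assumes "0 < l" "f \<in> H1 l" "g \<in> L2 l" "weak_deriv l f g"
  shows "AE x in leb l. wd l f x = g x"
  using assms by (intro weak_deriv_unique[of l _ f] L2_integrable wd_L2 wd_weak_deriv)

lemma L2_diff:
  assumes f: "f \<in> L2 l" and g: "g \<in> L2 l" shows "(\<lambda>x. f x - g x) \<in> L2 l"
proof -
  have m: "f \<in> borel_measurable (leb l)" "g \<in> borel_measurable (leb l)"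
    and i: "integrable (leb l) (\<lambda>x. (f x)\<^sup>2)" "integrable (leb l) (\<lambda>x. (g x)\<^sup>2)"
    using f g by (auto simp: L2_def)
  have "integrable (leb l) (\<lambda>x. (f x - g x)\<^sup>2)"
  proof (rule Bochner_Integration.integrable_bound)
    show "integrable (leb l) (\<lambda>x. 2 * (f x)\<^sup>2 + 2 * (g x)\<^sup>2)" using i by simp
    show "(\<lambda>x. (f x - g x)\<^sup>2) \<in> borel_measurable (leb l)" using m by simp
    have "(y - z)\<^sup>2 \<le> 2 * y\<^sup>2 + 2 * z\<^sup>2" for y z :: real
      using zero_le_power2[of "y + z"] by (simp add: power2_eq_square algebra_simps)
    then show "AE x in leb l. norm ((f x - g x)\<^sup>2) \<le> norm (2 * (f x)\<^sup>2 + 2 * (g x)\<^sup>2)" by simp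
  qed
  with m show ?thesis by (simp add: L2_def)
qed

lemma H1_integrable: "f \<in> H1 l \<Longrightarrow> integrable (leb l) f"
  by (simp add: H1_def L2_integrable)

lemma H1_diff:
  assumes f: "f \<in> H1 l" and g: "g \<in> H1 l" shows "(\<lambda>x. f x - g x) \<in> H1 l"
proof -
  have "weak_deriv l (\<lambda>x. f x - g x) (\<lambda>x. wd l f x - wd l g x)"
    unfolding weak_deriv_def
  proof (intro allI impI)
    fix \<phi> \<phi>' assume t: "test_function l \<phi> \<phi>'"
    have i: "integrable (leb l) (\<lambda>x. wd l f x * \<phi> x)" "integrable (leb l) (\<lambda>x. wd l g x * \<phi> x)"
       "integrable (leb l) (\<lambda>x. f x * \<phi>' x)" "integrable (leb l) (\<lambda>x. g x * \<phi>' x)"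
      by (intro integrable_mult_continuous test_function_continuous[OF t] H1_integrable
          L2_integrable[OF wd_L2] f g)+
    then show "(LINT x|leb l. (f x - g x) * \<phi>' x) = - (LINT x|leb l. (wd l f x - wd l g x) * \<phi> x)"
      using wd_weak_deriv[OF f] wd_weak_deriv[OF g] t by (simp add: left_diff_distrib weak_deriv_def)
  qed
  then show ?thesis using f g wd_L2[OF f] wd_L2[OF g]
    by (auto simp: H1_def intro!: L2_diff continuous_intros)
qed

lemma L2_norm_le_H1_norm: "L2_norm l f \<le> H1_norm l f" "L2_norm l (wd l f) \<le> H1_norm l f"
  unfolding H1_norm_def by (simp_all add: real_le_rsqrt)

lemma trace_bound:
  assumes l: "0 < l" and f: "f \<in> H1 l" and p: "p = 0 \<or> p = l"
  shows "\<bar>f p\<bar> \<le> sqrt l * (1 + l) / l * H1_norm l f"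
proof -
  have fi: "integrable (leb l) f" and fc: "continuous_on {0..l} f"
    using f by (auto simp: H1_def intro: L2_integrable)
  have wi: "integrable (leb l) (wd l f)" using L2_integrable wd_L2 f by blast
  \<comment> \<open>An affine weight that vanishes at the other end point.\<close>
  define k where "k x = (if p = 0 then l - x else x)" for x
  define s :: real where "s = (if p = 0 then - 1 else 1)"
  have kb: "\<bar>k x\<bar> \<le> l" if "x \<in> {0..l}" for x using that by (auto simp: k_def)
  have D: "(k has_real_derivative s) (at x)" for x
    unfolding k_def[abs_def] s_def by (cases "p = 0") (auto intro!: derivative_eq_intros)
  have kc: "continuous_on S k" for S
    by (rule DERIV_continuous_on) (rule has_field_derivative_at_within[OF D])
  have "(LINT x|leb l. f x * s) + (LINT x|leb l. wd l f x * k x) = f l * k l - f 0 * k 0"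
    by (intro weak_deriv_integration_by_parts l fc wi wd_weak_deriv f D continuous_intros)
  also have "\<bar>\<dots>\<bar> = \<bar>f p\<bar> * l" using p l by (auto simp: k_def abs_mult)
  finally have "\<bar>f p\<bar> * l \<le> \<bar>LINT x|leb l. f x * s\<bar> + \<bar>LINT x|leb l. wd l f x * k x\<bar>" by linarith
  also have "\<bar>LINT x|leb l. f x * s\<bar> \<le> (LINT x|leb l. \<bar>f x\<bar>)"
    using integral_norm_bound[of "leb l" f] by (auto simp: s_def abs_mult)
  also have "\<bar>LINT x|leb l. wd l f x * k x\<bar> \<le> (LINT x|leb l. \<bar>wd l f x\<bar> * l)"
  proof (rule order_trans[OF integral_norm_bound[of "leb l" "\<lambda>x. wd l f x * k x", unfolded real_norm_def] integral_mono])
    show "integrable (leb l) (\<lambda>x. \<bar>wd l f x * k x\<bar>)"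
      using integrable_mult_continuous[OF wi kc] by simp
    show "\<bar>wd l f x * k x\<bar> \<le> \<bar>wd l f x\<bar> * l" if "x \<in> space (leb l)" for x
      using kb[of x] that by (simp add: abs_mult mult_left_mono)
  qed (use wi in auto)
  also have "(LINT x|leb l. \<bar>wd l f x\<bar> * l) = (LINT x|leb l. \<bar>wd l f x\<bar>) * l" by simp
  also have "(LINT x|leb l. \<bar>f x\<bar>) + (LINT x|leb l. \<bar>wd l f x\<bar>) * l
      \<le> sqrt l * H1_norm l f + sqrt l * H1_norm l f * l"
  proof (intro add_mono mult_right_mono)
    have "f \<in> L2 l" using f by (simp add: H1_def)
    from L1_le_L2_norm[OF this l] show "(LINT x|leb l. \<bar>f x\<bar>) \<le> sqrt l * H1_norm l f"
      using mult_left_mono[OF L2_norm_le_H1_norm(1)[of l f], of "sqrt l"] l by (simp only: real_sqrt_ge_0_iff) linarith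
    from L1_le_L2_norm[OF wd_L2[OF f] l] show "(LINT x|leb l. \<bar>wd l f x\<bar>) \<le> sqrt l * H1_norm l f"
      using mult_left_mono[OF L2_norm_le_H1_norm(2)[of l f], of "sqrt l"] l by (simp only: real_sqrt_ge_0_iff) linarith
  qed (use l in simp)
  finally show ?thesis using l by (simp add: field_simps)
qed

text \<open>Point evaluation at an end point is bounded on \<open>H\<^sup>1\<close>, so \<open>u t p\<close> is the limit of the values of
  the simple functions that approximate \<open>u\<close>.\<close>

lemma integrable_trace:
  assumes u: "u \<in> L2_Bochner T (H1 a) (H1_norm a)" and a: "0 < a" and p: "p = 0 \<or> p = a"
  shows "integrable (leb T) (\<lambda>t. u t p)"
proof -
  define C where "C = sqrt a * (1 + a) / a"
  have C: "0 \<le> C" using a by (simp add: C_def)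
  have uH: "AE t in leb T. u t \<in> H1 a"
    and uI: "integrable (leb T) (\<lambda>t. (H1_norm a (u t))\<^sup>2)"
    using u by (auto simp: L2_Bochner_def)
  obtain s where s: "\<And>n::nat. simple_function (leb T) (s n)" "\<And>n t. s n t \<in> H1 a"
    and lim: "AE t in leb T. (\<lambda>n. H1_norm a (\<lambda>x. s n t x - u t x)) \<longlonglongrightarrow> 0"
    using u unfolding L2_Bochner_def strongly_measurable_def by blast
  have sm: "(\<lambda>t. s n t p) \<in> borel_measurable (leb T)" for n
    using simple_function_compose1[OF s(1), of "\<lambda>f. f p"] by (rule borel_measurable_simple_function)
  have "AE t in leb T. (\<lambda>n. s n t p) \<longlonglongrightarrow> u t p"
    using uH lim
  proof eventually_elim
    case (elim t)
    have "(\<lambda>n. s n t p - u t p) \<longlonglongrightarrow> 0"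
    proof (rule Lim_null_comparison)
      show "\<forall>\<^sub>F n in sequentially. norm (s n t p - u t p) \<le> C * H1_norm a (\<lambda>x. s n t x - u t x)"
        using trace_bound[OF a H1_diff[OF s(2) elim(1)] p] by (intro always_eventually) (simp add: C_def)
      show "(\<lambda>n. C * H1_norm a (\<lambda>x. s n t x - u t x)) \<longlonglongrightarrow> 0"
        using tendsto_mult_left[OF elim(2), of C] by simp
    qed
    then show ?case by (simp add: LIM_zero_iff)
  qed
  then have "AE t in leb T. lim (\<lambda>n. s n t p) = u t p"
    by eventually_elim (rule limI)
  moreover have "(\<lambda>t. lim (\<lambda>n. s n t p)) \<in> borel_measurable (leb T)"
    using sm by (rule borel_measurable_lim_metric)
  ultimately have um: "(\<lambda>t. u t p) \<in> borel_measurable (leb T)"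
    by (blast intro: measurable_leb_AE)
  show ?thesis
  proof (rule Bochner_Integration.integrable_bound)
    show "integrable (leb T) (\<lambda>t. C * (1 + (H1_norm a (u t))\<^sup>2))"
      using uI by (auto intro!: finite_measure.integrable_const finite_measure_leb)
    show "AE t in leb T. norm (u t p) \<le> norm (C * (1 + (H1_norm a (u t))\<^sup>2))"
      using uH
    proof eventually_elim
      case (elim t)
      have "\<bar>u t p\<bar> \<le> C * H1_norm a (u t)" using trace_bound[OF a elim p] by (simp add: C_def)
      also have "H1_norm a (u t) \<le> 1 + (H1_norm a (u t))\<^sup>2"
      proof -
        have "0 \<le> (H1_norm a (u t) - 1)\<^sup>2" "0 \<le> H1_norm a (u t)" by (simp_all add: H1_norm_def)
        then show ?thesis by (simp only: power2_diff) simp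
      qed
      finally show ?case using C by (simp add: mult_left_mono abs_mult)
    qed
  qed (rule um)
qed

section \<open>The weak equation tested in space and time\<close>

lemma conductivity_measurable: "conductivity b \<gamma>\<^sub>1 \<gamma>\<^sub>2 \<in> borel_measurable (leb l)"
proof -
  have "conductivity b \<gamma>\<^sub>1 \<gamma>\<^sub>2 \<in> borel_measurable borel"
    unfolding conductivity_def[abs_def] by measurable
  then have "conductivity b \<gamma>\<^sub>1 \<gamma>\<^sub>2 \<in> borel_measurable lebesgue"
    by (simp add: measurable_completion)
  then show ?thesis by (rule measurable_restrict_space1)
qed

text \<open>If the flux \<open>k = \<gamma> \<phi>'\<close> of the test function is \<open>C\<^sup>1\<close> with derivative \<open>q\<close>, the energy form can
  be integrated by parts in spite of the jump of \<open>\<gamma>\<close>: the derivative is moved from \<open>f\<close> to \<open>k\<close>.\<close>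

lemma energy_form_eq:
  assumes a: "0 < a" and f: "f \<in> H1 a" and \<phi>: "\<phi> \<in> H1 a"
    and p: "p \<in> L2 a" "weak_deriv a \<phi> p"
    and kp: "\<And>x. 0 < x \<Longrightarrow> x < a \<Longrightarrow> k x = conductivity b \<gamma>\<^sub>1 \<gamma>\<^sub>2 x * p x"
    and k: "\<And>x. (k has_real_derivative q x) (at x)" and q: "continuous_on UNIV q"
  shows "(LINT x|leb a. conductivity b \<gamma>\<^sub>1 \<gamma>\<^sub>2 x * wd a f x * wd a \<phi> x)
    = f a * k a - f 0 * k 0 - (LINT x|leb a. f x * q x)"
proof -
  have kc: "continuous_on S k" for S
    by (rule DERIV_continuous_on) (rule has_field_derivative_at_within[OF k])
  have "AE x in leb a. conductivity b \<gamma>\<^sub>1 \<gamma>\<^sub>2 x * wd a f x * wd a \<phi> x = wd a f x * k x"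
    using wd_AE_eq[OF a \<phi> p] AE_space by eventually_elim (simp add: kp)
  then have "(LINT x|leb a. conductivity b \<gamma>\<^sub>1 \<gamma>\<^sub>2 x * wd a f x * wd a \<phi> x) = (LINT x|leb a. wd a f x * k x)"
  proof (rule integral_cong_AE[rotated 2])
    show "(\<lambda>x. conductivity b \<gamma>\<^sub>1 \<gamma>\<^sub>2 x * wd a f x * wd a \<phi> x) \<in> borel_measurable (leb a)"
      using conductivity_measurable wd_L2[OF f] wd_L2[OF \<phi>]
      by (auto simp: L2_def intro!: borel_measurable_times)
    show "(\<lambda>x. wd a f x * k x) \<in> borel_measurable (leb a)"
      using wd_L2[OF f] measurable_leb_continuous[OF kc] by (auto simp: L2_def intro!: borel_measurable_times)
  qed
  also have "\<dots> = f a * k a - f 0 * k 0 - (LINT x|leb a. f x * q x)"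
    using weak_deriv_integration_by_parts[OF a _ L2_integrable[OF wd_L2[OF f]] wd_weak_deriv[OF f] k q] f
    by (simp add: H1_def)
  finally show ?thesis .
qed

lemma pairing_continuous:
  assumes a: "0 < a" and U: "\<And>t. t \<in> {0..T} \<Longrightarrow> U t \<in> L2 a"
    and Ucont: "\<And>s. s \<in> {0..T} \<Longrightarrow> ((\<lambda>t. L2_norm a (\<lambda>x. U t x - U s x)) \<longlongrightarrow> 0) (at s within {0..T})"
    and \<phi>: "continuous_on {0..a} \<phi>"
  shows "continuous_on {0..T} (\<lambda>t. LINT x|leb a. U t x * \<phi> x)"
  unfolding continuous_on
proof
  fix s assume s: "s \<in> {0..T}"
  obtain B where B: "0 < B" "\<And>x. 0 \<le> x \<Longrightarrow> x \<le> a \<Longrightarrow> norm (\<phi> x) \<le> B"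
    using continuous_Icc_bound[OF \<phi>] by blast
  have "((\<lambda>t. (LINT x|leb a. U t x * \<phi> x) - (LINT x|leb a. U s x * \<phi> x)) \<longlongrightarrow> 0) (at s within {0..T})"
  proof (rule Lim_null_comparison)
    show "((\<lambda>t. B * (sqrt a * L2_norm a (\<lambda>x. U t x - U s x))) \<longlongrightarrow> 0) (at s within {0..T})"
      using tendsto_mult_left[OF tendsto_mult_left[OF Ucont[OF s], of "sqrt a"], of B] by simp
    show "\<forall>\<^sub>F t in at s within {0..T}. norm ((LINT x|leb a. U t x * \<phi> x) - (LINT x|leb a. U s x * \<phi> x))
        \<le> B * (sqrt a * L2_norm a (\<lambda>x. U t x - U s x))"
      unfolding eventually_at_topological
    proof (intro exI[of _ UNIV] conjI ballI impI)
      fix t assume t: "t \<in> {0..T}"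
      have d: "(\<lambda>x. U t x - U s x) \<in> L2 a" by (intro L2_diff U s t)
      have "(LINT x|leb a. U t x * \<phi> x) - (LINT x|leb a. U s x * \<phi> x)
          = (LINT x|leb a. (U t x - U s x) * \<phi> x)"
        using integrable_mult_continuous[OF L2_integrable[OF U[OF t]] \<phi>]
          integrable_mult_continuous[OF L2_integrable[OF U[OF s]] \<phi>]
        by (simp add: left_diff_distrib)
      also have "norm \<dots> \<le> (LINT x|leb a. norm ((U t x - U s x) * \<phi> x))"
        by (rule integral_norm_bound)
      also have "\<dots> \<le> (LINT x|leb a. B * \<bar>U t x - U s x\<bar>)"
      proof (rule integral_mono)
        show "integrable (leb a) (\<lambda>x. norm ((U t x - U s x) * \<phi> x))"
          using integrable_mult_continuous[OF L2_integrable[OF d] \<phi>] by (rule integrable_norm)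
        show "integrable (leb a) (\<lambda>x. B * \<bar>U t x - U s x\<bar>)"
          using L2_integrable[OF d] by simp
        show "norm ((U t x - U s x) * \<phi> x) \<le> B * \<bar>U t x - U s x\<bar>" if "x \<in> space (leb a)" for x
          using B(2)[of x] that by (simp add: abs_mult mult.commute[of B] mult_left_mono)
      qed
      also have "\<dots> = B * (LINT x|leb a. \<bar>U t x - U s x\<bar>)" by simp
      also have "\<dots> \<le> B * (sqrt a * L2_norm a (\<lambda>x. U t x - U s x))"
        using L1_le_L2_norm[OF d a] B(1) by (intro mult_left_mono) auto
      finally show "norm ((LINT x|leb a. U t x * \<phi> x) - (LINT x|leb a. U s x * \<phi> x))
        \<le> B * (sqrt a * L2_norm a (\<lambda>x. U t x - U s x))" .
    qed auto
  qed
  then show "((\<lambda>t. LINT x|leb a. U t x * \<phi> x) \<longlongrightarrow> (LINT x|leb a. U s x * \<phi> x)) (at s within {0..T})"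
    by (rule LIM_zero_cancel)
qed

lemma pairing_AE:
  assumes a: "0 < a" and U: "\<And>t. t \<in> {0..T} \<Longrightarrow> U t \<in> L2 a"
    and uH: "AE t in leb T. u t \<in> H1 a"
    and Uae: "AE t in leb T. AE x in leb a. U t x = u t x"
    and \<phi>: "continuous_on {0..a} \<phi>"
  shows "AE t in leb T. (LINT x|leb a. u t x * \<phi> x) = (LINT x|leb a. U t x * \<phi> x)"
  using uH Uae AE_space
proof eventually_elim
  case (elim t)
  then have "integrable (leb a) (u t)" "integrable (leb a) (U t)"
    using U[of t] by (auto intro: L2_integrable H1_integrable)
  then have "integrable (leb a) (\<lambda>x. u t x * \<phi> x)" "integrable (leb a) (\<lambda>x. U t x * \<phi> x)"
    by (auto intro: integrable_mult_continuous \<phi>)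
  then show ?case using elim(2) by (intro integral_cong_AE) auto
qed

lemma weak_deriv_AE_cong:
  assumes w: "weak_deriv l f g"
    and f: "f' \<in> borel_measurable (leb l)" "AE x in leb l. f x = f' x"
    and g: "g' \<in> borel_measurable (leb l)" "AE x in leb l. g x = g' x"
  shows "weak_deriv l f' g'"
  unfolding weak_deriv_def
proof (intro allI impI)
  fix \<phi> \<phi>' assume t: "test_function l \<phi> \<phi>'"
  have fm: "f \<in> borel_measurable (leb l)" and gm: "g \<in> borel_measurable (leb l)"
    using f g by (auto intro: measurable_leb_AE AE_symmetric)
  have tm: "\<phi> \<in> borel_measurable (leb l)" "\<phi>' \<in> borel_measurable (leb l)"
    using test_function_continuous[OF t] by (auto intro: measurable_leb_continuous)
  have "(LINT x|leb l. f x * \<phi>' x) = (LINT x|leb l. f' x * \<phi>' x)"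
    using f fm tm by (intro integral_cong_AE) (auto elim: eventually_mono intro: borel_measurable_times)
  moreover have "(LINT x|leb l. g x * \<phi> x) = (LINT x|leb l. g' x * \<phi> x)"
    using g gm tm by (intro integral_cong_AE) (auto elim: eventually_mono intro: borel_measurable_times)
  ultimately show "(LINT x|leb l. f' x * \<phi>' x) = - (LINT x|leb l. g' x * \<phi> x)"
    using w t by (simp add: weak_deriv_def)
qed

text \<open>The weak equation tested with \<open>\<phi>(x) W(t)\<close>, after integration by parts in space and time. Here
  \<open>U\<close> is the version of \<open>u\<close> that is continuous in time with values in \<open>L\<^sup>2\<close>, \<open>p\<close> is the weak
  derivative of \<open>\<phi>\<close>, and \<open>q\<close> is the derivative of the flux \<open>k = \<gamma> \<phi>'\<close>.\<close>

lemma moment_identity_real: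
  assumes a: "0 < a" and T: "0 < T"
    and sol: "heat_solution a b \<gamma>\<^sub>1 \<gamma>\<^sub>2 T u u\<^sub>x\<^sub>0 u\<^sub>x\<^sub>a"
    and U: "\<And>t. t \<in> {0..T} \<Longrightarrow> U t \<in> L2 a"
    and Ucont: "\<And>s. s \<in> {0..T} \<Longrightarrow> ((\<lambda>t. L2_norm a (\<lambda>x. U t x - U s x)) \<longlongrightarrow> 0) (at s within {0..T})"
    and Uae: "AE t in leb T. AE x in leb a. U t x = u t x"
    and U0: "AE x in leb a. U 0 x = 0"
    and \<phi>: "\<phi> \<in> H1 a" and p: "p \<in> L2 a" "weak_deriv a \<phi> p"
    and kp: "\<And>x. 0 < x \<Longrightarrow> x < a \<Longrightarrow> k x = conductivity b \<gamma>\<^sub>1 \<gamma>\<^sub>2 x * p x"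
    and k: "\<And>x. (k has_real_derivative q x) (at x)" and q: "continuous_on UNIV q"
    and W: "\<And>t. (W has_real_derivative W' t) (at t)" and W': "continuous_on UNIV W'"
  shows "(LINT t|leb T. (LINT x|leb a. U t x * \<phi> x) * W' t)
    + (LINT t|leb T. (LINT x|leb a. U t x * q x) * W t)
    + \<gamma>\<^sub>2 * \<phi> a * (LINT t|leb T. u\<^sub>x\<^sub>a t * W t) - \<gamma>\<^sub>1 * \<phi> 0 * (LINT t|leb T. u\<^sub>x\<^sub>0 t * W t)
    - k a * (LINT t|leb T. u t a * W t) + k 0 * (LINT t|leb T. u t 0 * W t)
    = (LINT x|leb a. U T x * \<phi> x) * W T"
proof -
  define H where "H \<psi> t = (LINT x|leb a. U t x * \<psi> x)" for \<psi> t
  \<comment> \<open>The weak equation and \<open>energy_form_eq\<close> give \<open>F t \<phi> = E t\<close> for almost every \<open>t\<close>. All terms of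
    \<open>E\<close> are integrable, which makes \<open>\<lambda>t. F t \<phi>\<close> measurable.\<close>
  define E where "E t = \<gamma>\<^sub>2 * \<phi> a * u\<^sub>x\<^sub>a t - \<gamma>\<^sub>1 * \<phi> 0 * u\<^sub>x\<^sub>0 t - k a * u t a + k 0 * u t 0 + H q t" for t
  have uB: "u \<in> L2_Bochner T (H1 a) (H1_norm a)" and x0: "u\<^sub>x\<^sub>0 \<in> L2 T" and xa: "u\<^sub>x\<^sub>a \<in> L2 T"
    using sol by (auto simp: heat_solution_def)
  have uH: "AE t in leb T. u t \<in> H1 a" using uB by (simp add: L2_Bochner_def)
  obtain F where F: "time_deriv a T u F"
    and eq: "AE t in leb T. F t \<phi> + (LINT x|leb a. conductivity b \<gamma>\<^sub>1 \<gamma>\<^sub>2 x * wd a (u t) x * wd a \<phi> x)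
             = \<gamma>\<^sub>2 * u\<^sub>x\<^sub>a t * \<phi> a - \<gamma>\<^sub>1 * u\<^sub>x\<^sub>0 t * \<phi> 0"
    using sol \<phi> unfolding heat_solution_def by blast
  have \<phi>c: "continuous_on {0..a} \<phi>" using \<phi> by (simp add: H1_def)
  have qc: "continuous_on S q" for S using q continuous_on_subset by blast
  have Wc: "continuous_on S W" for S
    by (rule DERIV_continuous_on) (rule has_field_derivative_at_within[OF W])
  have Hc: "continuous_on {0..T} (H \<psi>)" if "continuous_on {0..a} \<psi>" for \<psi>
    unfolding H_def[abs_def] by (rule pairing_continuous[OF a U Ucont that])
  have HAE: "AE t in leb T. (LINT x|leb a. u t x * \<psi> x) = H \<psi> t" if "continuous_on {0..a} \<psi>" for \<psi>
    unfolding H_def by (rule pairing_AE[OF a U uH Uae that])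
  have int: "integrable (leb T) u\<^sub>x\<^sub>a" "integrable (leb T) u\<^sub>x\<^sub>0" "integrable (leb T) (\<lambda>t. u t a)"
    "integrable (leb T) (\<lambda>t. u t 0)" "integrable (leb T) (H q)"
    using integrable_trace[OF uB a] L2_integrable[OF x0] L2_integrable[OF xa]
      integrable_leb_continuous[OF Hc[OF qc]] by auto
  have Ei: "integrable (leb T) E" unfolding E_def[abs_def] using int by simp
  have "AE t in leb T. F t \<phi> = E t"
    using eq uH HAE[OF qc]
  proof eventually_elim
    case (elim t)
    then show ?case
      using energy_form_eq[OF a elim(2) \<phi> p kp k q] by (simp add: E_def algebra_simps)
  qed
  moreover have "weak_deriv T (\<lambda>t. LINT x|leb a. u t x * \<phi> x) (\<lambda>t. F t \<phi>)"
    using F \<phi> by (simp add: time_deriv_def)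
  ultimately have "weak_deriv T (H \<phi>) E"
    using weak_deriv_AE_cong[OF _ measurable_leb_continuous[OF Hc[OF \<phi>c]] HAE[OF \<phi>c]
      borel_measurable_integrable[OF Ei]] by blast
  then have 1: "(LINT t|leb T. H \<phi> t * W' t) + (LINT t|leb T. E t * W t) = H \<phi> T * W T - H \<phi> 0 * W 0"
    by (intro weak_deriv_integration_by_parts T Hc \<phi>c Ei W W')
  have "H \<phi> 0 = (LINT x|leb a. 0)"
    unfolding H_def
  proof (rule integral_cong_AE)
    show "(\<lambda>x. U 0 x * \<phi> x) \<in> borel_measurable (leb a)"
      using integrable_mult_continuous[OF L2_integrable[OF U] \<phi>c] T by simp
  qed (use U0 in auto)
  moreover have "(LINT t|leb T. E t * W t) = (LINT t|leb T. \<gamma>\<^sub>2 * \<phi> a * (u\<^sub>x\<^sub>a t * W t)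
      - \<gamma>\<^sub>1 * \<phi> 0 * (u\<^sub>x\<^sub>0 t * W t) - k a * (u t a * W t) + k 0 * (u t 0 * W t) + H q t * W t)"
    by (simp add: E_def algebra_simps)
  moreover have "\<dots> = \<gamma>\<^sub>2 * \<phi> a * (LINT t|leb T. u\<^sub>x\<^sub>a t * W t)
      - \<gamma>\<^sub>1 * \<phi> 0 * (LINT t|leb T. u\<^sub>x\<^sub>0 t * W t)
      - k a * (LINT t|leb T. u t a * W t) + k 0 * (LINT t|leb T. u t 0 * W t)
      + (LINT t|leb T. H q t * W t)"
    using int[THEN integrable_mult_continuous[OF _ Wc]] by simp
  ultimately show ?thesis using 1 unfolding H_def by simp
qed

lemma integral_complex_split:
  fixes f :: "real \<Rightarrow> real" and W :: "real \<Rightarrow> complex"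
  assumes f: "integrable (leb l) f" and W: "continuous_on {0..l} W"
  shows "(LINT t|leb l. of_real (f t) * W t)
    = of_real (LINT t|leb l. f t * Re (W t)) + \<i> * of_real (LINT t|leb l. f t * Im (W t))"
proof -
  have "integrable (leb l) (\<lambda>t. f t *\<^sub>R W t)" by (rule integrable_scaleR_continuous[OF f W])
  then have "integrable (leb l) (\<lambda>t. of_real (f t) * W t)" by (simp add: scaleR_conv_of_real)
  then show ?thesis by (intro complex_eqI) (simp_all flip: integral_Re integral_Im)
qed

text \<open>The same identity for a complex weight \<open>W\<close> in time.\<close>

lemma moment_identity:
  fixes W W' :: "real \<Rightarrow> complex"
  assumes a: "0 < a" and T: "0 < T"
    and sol: "heat_solution a b \<gamma>\<^sub>1 \<gamma>\<^sub>2 T u u\<^sub>x\<^sub>0 u\<^sub>x\<^sub>a"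
    and U: "\<And>t. t \<in> {0..T} \<Longrightarrow> U t \<in> L2 a"
    and Ucont: "\<And>s. s \<in> {0..T} \<Longrightarrow> ((\<lambda>t. L2_norm a (\<lambda>x. U t x - U s x)) \<longlongrightarrow> 0) (at s within {0..T})"
    and Uae: "AE t in leb T. AE x in leb a. U t x = u t x"
    and U0: "AE x in leb a. U 0 x = 0"
    and \<phi>: "\<phi> \<in> H1 a" and p: "p \<in> L2 a" "weak_deriv a \<phi> p"
    and kp: "\<And>x. 0 < x \<Longrightarrow> x < a \<Longrightarrow> k x = conductivity b \<gamma>\<^sub>1 \<gamma>\<^sub>2 x * p x"
    and k: "\<And>x. (k has_real_derivative q x) (at x)" and q: "continuous_on UNIV q"
    and W: "\<And>t. (W has_vector_derivative W' t) (at t)" and W': "continuous_on UNIV W'"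
  shows "(LINT t|leb T. of_real (LINT x|leb a. U t x * \<phi> x) * W' t)
    + (LINT t|leb T. of_real (LINT x|leb a. U t x * q x) * W t)
    + of_real (\<gamma>\<^sub>2 * \<phi> a) * (LINT t|leb T. of_real (u\<^sub>x\<^sub>a t) * W t)
    - of_real (\<gamma>\<^sub>1 * \<phi> 0) * (LINT t|leb T. of_real (u\<^sub>x\<^sub>0 t) * W t)
    - of_real (k a) * (LINT t|leb T. of_real (u t a) * W t)
    + of_real (k 0) * (LINT t|leb T. of_real (u t 0) * W t)
    = of_real (LINT x|leb a. U T x * \<phi> x) * W T"
proof -
  have uB: "u \<in> L2_Bochner T (H1 a) (H1_norm a)" and x0: "u\<^sub>x\<^sub>0 \<in> L2 T" and xa: "u\<^sub>x\<^sub>a \<in> L2 T"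
    using sol by (auto simp: heat_solution_def)
  have \<phi>c: "continuous_on {0..a} \<phi>" using \<phi> by (simp add: H1_def)
  have qc: "continuous_on S q" for S using q continuous_on_subset by blast
  have Wc: "continuous_on S W" for S
    by (rule continuous_on_vector_derivative) (rule has_vector_derivative_at_within[OF W])
  have W'c: "continuous_on S W'" for S using W' continuous_on_subset by blast
  have DRe: "((\<lambda>t. Re (W t)) has_real_derivative Re (W' t)) (at t)" for t
    using bounded_linear.has_vector_derivative[OF bounded_linear_Re W] by (simp add: has_real_derivative_iff_has_vector_derivative)
  have DIm: "((\<lambda>t. Im (W t)) has_real_derivative Im (W' t)) (at t)" for t
    using bounded_linear.has_vector_derivative[OF bounded_linear_Im W] by (simp add: has_real_derivative_iff_has_vector_derivative)
  have int: "integrable (leb T) u\<^sub>x\<^sub>a" "integrable (leb T) u\<^sub>x\<^sub>0" "integrable (leb T) (\<lambda>t. u t a)"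
    "integrable (leb T) (\<lambda>t. u t 0)" "integrable (leb T) (\<lambda>t. LINT x|leb a. U t x * q x)"
    "integrable (leb T) (\<lambda>t. LINT x|leb a. U t x * \<phi> x)"
    using integrable_trace[OF uB a] L2_integrable[OF x0] L2_integrable[OF xa]
      integrable_leb_continuous[OF pairing_continuous[OF a U Ucont]] qc \<phi>c by auto
  note R = moment_identity_real[OF a T sol U Ucont Uae U0 \<phi> p kp k q DRe continuous_on_Re[OF W']]
  note I = moment_identity_real[OF a T sol U Ucont Uae U0 \<phi> p kp k q DIm continuous_on_Im[OF W']]
  show ?thesis
    unfolding int(1-5)[THEN integral_complex_split[OF _ Wc]] integral_complex_split[OF int(6) W'c]
    using R I by (intro complex_eqI) (simp_all add: algebra_simps)
qed

section \<open>The solution of the adjoint transmission problem\<close>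

lemma piecewise_continuous:
  fixes g h :: "real \<Rightarrow> 'b::topological_space"
  assumes "continuous_on UNIV g" "continuous_on UNIV h" "g b = h b"
  shows "continuous_on UNIV (\<lambda>x. if x < b then g x else h x)"
proof -
  have "continuous_on ({..b} \<union> {b..}) (\<lambda>x. if x < b then g x else h x)"
    using assms by (intro continuous_on_If) (auto intro: continuous_on_subset)
  moreover have "{..b} \<union> {b..} = UNIV" by auto
  ultimately show ?thesis by simp
qed

lemma piecewise_vector_derivative:
  fixes g h :: "real \<Rightarrow> 'b::real_normed_vector"
  assumes g: "\<And>x. (g has_vector_derivative g' x) (at x)"
    and h: "\<And>x. (h has_vector_derivative h' x) (at x)"
    and match: "g b = h b" "g' b = h' b"
  shows "((\<lambda>x. if x < b then g x else h x) has_vector_derivative (if x < b then g' x else h' x)) (at x)"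
proof -
  have "((\<lambda>x. if x \<in> {..<b} then g x else h x) has_vector_derivative
      (if x \<in> {..<b} then g' x else h' x)) (at x within UNIV)"
    by (rule has_vector_derivative_If_within_closures[where T = "{b..}"])
       (use match in \<open>auto intro: has_vector_derivative_at_within[OF g] has_vector_derivative_at_within[OF h]\<close>)
  then show ?thesis by simp
qed

lemma L2_bounded:
  assumes m: "f \<in> borel_measurable (leb l)" and B: "\<And>x. 0 < x \<Longrightarrow> x < l \<Longrightarrow> \<bar>f x\<bar> \<le> B"
  shows "f \<in> L2 l"
proof -
  have "integrable (leb l) (\<lambda>x. (f x)\<^sup>2)"
  proof (rule finite_measure.integrable_const_bound[OF finite_measure_leb])
    show "AE x in leb l. norm ((f x)\<^sup>2) \<le> B\<^sup>2"
      using B by (intro AE_I2) (fastforce simp: abs_le_square_iff[symmetric])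
  qed (use m in simp)
  with m show ?thesis by (simp add: L2_def)
qed

lemma piecewise_H1:
  fixes g h :: "real \<Rightarrow> real"
  assumes g: "\<And>x. (g has_real_derivative g' x) (at x)" "continuous_on UNIV g'"
    and h: "\<And>x. (h has_real_derivative h' x) (at x)" "continuous_on UNIV h'"
    and match: "g b = h b" and l: "0 < l"
  defines "f \<equiv> \<lambda>x. if x < b then g x else h x" and "p \<equiv> \<lambda>x. if x < b then g' x else h' x"
  shows "f \<in> H1 l" and "p \<in> L2 l" and "weak_deriv l f p"
proof -
  have gc: "continuous_on UNIV g" and hc: "continuous_on UNIV h"
    by (rule DERIV_continuous_on, rule has_field_derivative_at_within, rule g h)+
  have fc: "continuous_on S f" for S
    unfolding f_def using piecewise_continuous[OF gc hc match] continuous_on_subset by blast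
  obtain B1 where B1: "0 < B1" "\<And>x. 0 \<le> x \<Longrightarrow> x \<le> l \<Longrightarrow> norm (g' x) \<le> B1"
    using continuous_Icc_bound[OF continuous_on_subset[OF g(2)], of l] by blast
  obtain B2 where B2: "0 < B2" "\<And>x. 0 \<le> x \<Longrightarrow> x \<le> l \<Longrightarrow> norm (h' x) \<le> B2"
    using continuous_Icc_bound[OF continuous_on_subset[OF h(2)], of l] by blast
  have "p \<in> borel_measurable borel"
    unfolding p_def using g(2) h(2)
    by (intro measurable_If) (auto intro: borel_measurable_continuous_onI)
  then have "p \<in> borel_measurable lebesgue" by (simp add: measurable_completion)
  then have pm: "p \<in> borel_measurable (leb l)" by (rule measurable_restrict_space1)
  show p: "p \<in> L2 l"
  proof (rule L2_bounded[OF pm])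
    show "\<bar>p x\<bar> \<le> B1 + B2" if "0 < x" "x < l" for x
      using B1(1) B1(2)[of x] B2(1) B2(2)[of x] that by (simp add: p_def)
  qed
  show w: "weak_deriv l f p"
    unfolding weak_deriv_def
  proof (intro allI impI)
    fix \<phi> \<phi>' assume t: "test_function l \<phi> \<phi>'"
    have i: "integrable (leb l) (\<lambda>x. f x * \<phi>' x)" "integrable (leb l) (\<lambda>x. p x * \<phi> x)"
      by (intro integrable_mult_continuous integrable_leb_continuous[OF fc] L2_integrable[OF p]
          test_function_continuous[OF t])+
    have D: "(\<phi> has_real_derivative \<phi>' x) (at x)" for x using t by (simp add: test_function_def)
    have "\<phi> 0 = 0" "\<phi> l = 0" using t by (auto simp: test_function_def)
    moreover have "((\<lambda>x. f x * \<phi>' x + p x * \<phi> x) has_integral f l * \<phi> l - f 0 * \<phi> 0) {0..l}"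
    proof (rule fundamental_theorem_of_calculus_interior_strong[of "{b}"])
      show "continuous_on {0..l} (\<lambda>x. f x * \<phi> x)"
        by (intro continuous_on_mult fc test_function_continuous[OF t])
      fix x assume "x \<in> {0<..<l} - {b}"
      then consider "x < b" | "b < x" by force
      then have "(f has_real_derivative p x) (at x)"
      proof cases
        case 1
        have "(f has_real_derivative g' x) (at x)"
          by (rule has_field_derivative_transform_within_open[OF g(1), of "{..<b}"]) (use 1 in \<open>auto simp: f_def\<close>)
        then show ?thesis using 1 by (simp add: p_def)
      next
        case 2
        have "(f has_real_derivative h' x) (at x)"
          by (rule has_field_derivative_transform_within_open[OF h(1), of "{b<..}"]) (use 2 in \<open>auto simp: f_def\<close>)
        then show ?thesis using 2 by (simp add: p_def)
      qed
      from DERIV_mult[OF this D]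
      show "((\<lambda>x. f x * \<phi> x) has_vector_derivative f x * \<phi>' x + p x * \<phi> x) (at x)"
        by (simp add: has_real_derivative_iff_has_vector_derivative algebra_simps)
    qed (use l in auto)
    ultimately have "integral {0..l} (\<lambda>x. f x * \<phi>' x + p x * \<phi> x) = 0"
      by (simp add: integral_unique)
    then show "(LINT x|leb l. f x * \<phi>' x) = - (LINT x|leb l. p x * \<phi> x)"
      using integral_leb_eq_HK[of l "\<lambda>x. f x * \<phi>' x + p x * \<phi> x"] i by simp
  qed
  obtain B where "0 < B" "\<And>x. 0 \<le> x \<Longrightarrow> x \<le> l \<Longrightarrow> norm (f x) \<le> B"
    using continuous_Icc_bound[OF fc] by blast
  then have "f \<in> L2 l"
    by (intro L2_bounded[where B = B] measurable_leb_continuous fc) auto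
  then show "f \<in> H1 l" using p w fc by (auto simp: H1_def)
qed

text \<open>The coefficient \<open>A\<close>, in the solution \<open>\<Phi>\<close> below, of the exponential that for \<open>Re z < 0\<close> is
  largest at the outer end point \<open>0\<close> of \<open>]0,b[\<close>, as a function of \<open>\<epsilon> = exp (2 z\<^sub>2 (a - b))\<close>.\<close>

definition outer_amp :: "real \<Rightarrow> real \<Rightarrow> complex \<Rightarrow> complex" where
  "outer_amp \<gamma>\<^sub>1 \<gamma>\<^sub>2 \<epsilon> = ((1 + \<epsilon>) + of_real (sqrt \<gamma>\<^sub>2 / sqrt \<gamma>\<^sub>1) * (1 - \<epsilon>)) / 2"

text \<open>The coefficient \<open>B\<close> of the exponential that for \<open>Re z < 0\<close> is largest at the interface \<open>b\<close>.
  Its value at \<open>\<epsilon> = 0\<close> vanishes exactly when the two conductivities agree.\<close>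

definition inner_amp :: "real \<Rightarrow> real \<Rightarrow> complex \<Rightarrow> complex" where
  "inner_amp \<gamma>\<^sub>1 \<gamma>\<^sub>2 \<epsilon> = ((1 + \<epsilon>) - of_real (sqrt \<gamma>\<^sub>2 / sqrt \<gamma>\<^sub>1) * (1 - \<epsilon>)) / 2"

text \<open>The solution of \<open>(\<gamma> \<Phi>')' = z\<^sup>2 \<Phi>\<close> with \<open>\<Phi>'(a) = 0\<close>, for the conductivity \<open>\<gamma>\<^sub>1\<close> on \<open>]0,b[\<close> and
  \<open>\<gamma>\<^sub>2\<close> on \<open>]b,a[\<close>, normalised by \<open>\<Phi>(b) = 1 + \<epsilon>\<close>. With this scaling the two exponentials
  that make up \<open>\<Phi>\<close> on \<open>[b,a]\<close> have modulus at most \<open>1\<close> whenever \<open>Re z \<le> 0\<close>.\<close>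

locale transmission =
  fixes a b \<gamma>\<^sub>1 \<gamma>\<^sub>2 :: real and z :: complex
  assumes b: "0 < b" "b < a" and \<gamma>: "0 < \<gamma>\<^sub>1" "0 < \<gamma>\<^sub>2"
begin

text \<open>The wave numbers on the two sides of the interface.\<close>

definition "z1 = z / of_real (sqrt \<gamma>\<^sub>1)"
definition "z2 = z / of_real (sqrt \<gamma>\<^sub>2)"
text \<open>The ratio at \<open>b\<close> of the two exponentials that make up \<open>\<Phi>\<close> on \<open>[b,a]\<close>, and the coefficients
  on \<open>]0,b[\<close> determined by the continuity of \<open>\<Phi>\<close> and \<open>\<gamma> \<Phi>'\<close> at \<open>b\<close>.\<close>

definition "\<epsilon> = exp (2 * z2 * of_real (a - b))"
definition "A = outer_amp \<gamma>\<^sub>1 \<gamma>\<^sub>2 \<epsilon>"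
definition "B = inner_amp \<gamma>\<^sub>1 \<gamma>\<^sub>2 \<epsilon>"

text \<open>Exponentials of affine functions of a real variable.\<close>

definition exp_aff :: "complex \<Rightarrow> complex \<Rightarrow> real \<Rightarrow> complex" where
  "exp_aff c d x = exp (c * of_real x + d)"

text \<open>The two branches of \<open>\<Phi>\<close> and their derivatives, defined on the whole line:
  \<open>A exp (z\<^sub>1 (x - b)) + B exp (z\<^sub>1 (b - x))\<close> to the left of \<open>b\<close> and
  \<open>exp (z\<^sub>2 (x - b)) + exp (z\<^sub>2 (2 a - b - x))\<close> to the right.\<close>

definition "left x = A * exp_aff z1 (- z1 * of_real b) x + B * exp_aff (- z1) (z1 * of_real b) x"
definition "left' x = z1 * (A * exp_aff z1 (- z1 * of_real b) x - B * exp_aff (- z1) (z1 * of_real b) x)"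
definition "right x = exp_aff z2 (- z2 * of_real b) x + exp_aff (- z2) (z2 * of_real (2 * a - b)) x"
definition "right' x = z2 * (exp_aff z2 (- z2 * of_real b) x - exp_aff (- z2) (z2 * of_real (2 * a - b)) x)"

text \<open>The solution \<open>\<Phi>\<close>, its derivative \<open>P\<close> (weak at \<open>b\<close>), and its flux \<open>K = \<gamma> P\<close>.\<close>

definition "\<Phi> x = (if x < b then left x else right x)"
definition "P x = (if x < b then left' x else right' x)"
definition "K x = (if x < b then of_real \<gamma>\<^sub>1 * left' x else of_real \<gamma>\<^sub>2 * right' x)"

lemma exp_aff_deriv: "(exp_aff c d has_vector_derivative c * exp_aff c d x) (at x)"
proof -
  have "((\<lambda>w. exp (c * w + d)) has_field_derivative c * exp (c * of_real x + d)) (at (of_real x))"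
    by (auto intro!: derivative_eq_intros)
  from has_vector_derivative_real_field[OF this] show ?thesis
    by (simp add: exp_aff_def[abs_def])
qed

lemma exp_aff_continuous: "continuous_on S (exp_aff c d)"
  by (rule continuous_on_vector_derivative) (rule has_vector_derivative_at_within[OF exp_aff_deriv])

lemma gamma1_z1_squared: "of_real \<gamma>\<^sub>1 * z1 * z1 = z\<^sup>2" and gamma2_z2_squared: "of_real \<gamma>\<^sub>2 * z2 * z2 = z\<^sup>2"
  using \<gamma> by (auto simp: z1_def z2_def power2_eq_square simp flip: of_real_mult)

lemma left_deriv: "(left has_vector_derivative left' x) (at x)"
  unfolding left_def[abs_def] left'_def
  by (rule derivative_eq_intros exp_aff_deriv refl | simp add: algebra_simps)+

lemma right_deriv: "(right has_vector_derivative right' x) (at x)"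
  unfolding right_def[abs_def] right'_def
  by (rule derivative_eq_intros exp_aff_deriv refl | simp add: algebra_simps)+

lemma left'_deriv: "((\<lambda>x. of_real \<gamma>\<^sub>1 * left' x) has_vector_derivative z\<^sup>2 * left x) (at x)"
  unfolding left_def left'_def[abs_def] gamma1_z1_squared[symmetric]
  by (rule derivative_eq_intros exp_aff_deriv refl | simp add: algebra_simps)+

lemma right'_deriv: "((\<lambda>x. of_real \<gamma>\<^sub>2 * right' x) has_vector_derivative z\<^sup>2 * right x) (at x)"
  unfolding right_def right'_def[abs_def] gamma2_z2_squared[symmetric]
  by (rule derivative_eq_intros exp_aff_deriv refl | simp add: algebra_simps)+

lemma exp_product_eq_\<epsilon>: "exp (- (z2 * of_real b) + z2 * of_real (2 * a - b)) = \<epsilon>"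
  by (simp add: \<epsilon>_def algebra_simps)

lemma left_eq_right_at_interface: "left b = right b"
  using exp_product_eq_\<epsilon> by (simp add: left_def right_def exp_aff_def A_def B_def outer_amp_def inner_amp_def field_simps)

lemma flux_eq_at_interface: "of_real \<gamma>\<^sub>1 * left' b = of_real \<gamma>\<^sub>2 * right' b"
proof -
  have "left' b = z1 * (A - B)" "right' b = z2 * (1 - \<epsilon>)"
    using exp_product_eq_\<epsilon> by (simp_all add: left'_def right'_def exp_aff_def)
  moreover have "A - B = of_real (sqrt \<gamma>\<^sub>2 / sqrt \<gamma>\<^sub>1) * (1 - \<epsilon>)"
  proof -
    have "(v + w) / 2 - (v - w) / 2 = w" for v w :: complex by (simp add: field_simps)
    then show ?thesis by (simp only: A_def B_def outer_amp_def inner_amp_def)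
  qed
  moreover have "of_real \<gamma>\<^sub>1 * z1 * of_real (sqrt \<gamma>\<^sub>2 / sqrt \<gamma>\<^sub>1) = of_real \<gamma>\<^sub>2 * z2"
  proof -
    have "(s * s) * (z / s) * (r / s) = (r * r) * (z / r)" if "s \<noteq> 0" "r \<noteq> 0" for r s :: complex
      using that by (simp add: field_simps)
    from this[of "of_real (sqrt \<gamma>\<^sub>1)" "of_real (sqrt \<gamma>\<^sub>2)"]
    have "of_real (sqrt \<gamma>\<^sub>1 * sqrt \<gamma>\<^sub>1) * z1 * of_real (sqrt \<gamma>\<^sub>2 / sqrt \<gamma>\<^sub>1)
        = of_real (sqrt \<gamma>\<^sub>2 * sqrt \<gamma>\<^sub>2) * z2"
      using \<gamma> by (simp only: z1_def z2_def of_real_mult of_real_divide) simp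
    then show ?thesis using \<gamma> by simp
  qed
  ultimately show ?thesis by (simp only: mult.assoc[symmetric])
qed

text \<open>Unlike \<open>P\<close>, the flux is differentiable everywhere: its one-sided derivatives at \<open>b\<close> are
  \<open>z\<^sup>2 left b\<close> and \<open>z\<^sup>2 right b\<close>, which agree because \<open>\<Phi>\<close> is continuous.\<close>

lemma K_deriv: "(K has_vector_derivative z\<^sup>2 * \<Phi> x) (at x)"
proof -
  have "(K has_vector_derivative (if x < b then z\<^sup>2 * left x else z\<^sup>2 * right x)) (at x)"
    unfolding K_def[abs_def]
    by (rule piecewise_vector_derivative[OF left'_deriv right'_deriv flux_eq_at_interface]) (simp add: left_eq_right_at_interface)
  then show ?thesis by (simp add: \<Phi>_def if_distrib)
qed

lemma K_eq: "K x = of_real (conductivity b \<gamma>\<^sub>1 \<gamma>\<^sub>2 x) * P x"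
  by (simp add: K_def P_def conductivity_def)

lemma left_continuous: "continuous_on S left" "continuous_on S left'"
  unfolding left_def[abs_def] left'_def[abs_def] by (intro continuous_intros exp_aff_continuous)+

lemma right_continuous: "continuous_on S right" "continuous_on S right'"
  unfolding right_def[abs_def] right'_def[abs_def] by (intro continuous_intros exp_aff_continuous)+

lemma \<Phi>_continuous: "continuous_on S \<Phi>"
proof -
  have "continuous_on UNIV \<Phi>"
    unfolding \<Phi>_def[abs_def] by (intro piecewise_continuous left_continuous right_continuous left_eq_right_at_interface)
  then show ?thesis using continuous_on_subset by blast
qed

lemma \<Phi>_a: "\<Phi> a = 2 * exp (z2 * of_real (a - b))"
  using b by (simp add: \<Phi>_def right_def exp_aff_def algebra_simps)

lemma flux_at_a: "K a = 0"
  using b by (simp add: K_def right'_def exp_aff_def algebra_simps)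

lemma \<Phi>_0: "\<Phi> 0 = A * exp (- (z1 * of_real b)) + B * exp (z1 * of_real b)"
  using b by (simp add: \<Phi>_def left_def exp_aff_def)

lemma flux_at_0: "K 0 = of_real \<gamma>\<^sub>1 * z1 * (A * exp (- (z1 * of_real b)) - B * exp (z1 * of_real b))"
  using b by (simp add: K_def left'_def exp_aff_def)

lemma \<Phi>_bound:
  assumes z: "Re z \<le> 0" and x: "0 \<le> x" "x \<le> a"
  shows "cmod (\<Phi> x) \<le> cmod A * exp (- Re z * b / sqrt \<gamma>\<^sub>1) + cmod B + 2"
proof -
  have e: "cmod (exp_aff c d x) = exp (Re c * x + Re d)" for c d
    by (simp add: exp_aff_def)
  have z12: "Re z1 = Re z / sqrt \<gamma>\<^sub>1" "Re z2 = Re z / sqrt \<gamma>\<^sub>2"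
    by (simp_all add: z1_def z2_def)
  have neg: "Re z1 \<le> 0" "Re z2 \<le> 0"
    using z \<gamma> by (simp_all add: z12 divide_nonpos_pos)
  show ?thesis
  proof (cases "x < b")
    case True
    have "Re z1 * x + Re (- z1 * of_real b) \<le> - Re z * b / sqrt \<gamma>\<^sub>1"
      using mult_nonpos_nonneg[OF neg(1) x(1)] by (simp add: z12)
    then have 1: "cmod (exp_aff z1 (- z1 * of_real b) x) \<le> exp (- Re z * b / sqrt \<gamma>\<^sub>1)"
      by (simp add: e)
    have "Re (- z1) * x + Re (z1 * of_real b) = Re z1 * (b - x)" by (simp add: algebra_simps)
    also have "\<dots> \<le> 0" using neg True by (simp add: mult_nonpos_nonneg)
    finally have 2: "cmod (exp_aff (- z1) (z1 * of_real b) x) \<le> 1" by (simp only: e) simp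
    have "cmod (\<Phi> x) \<le> cmod A * cmod (exp_aff z1 (- z1 * of_real b) x)
        + cmod B * cmod (exp_aff (- z1) (z1 * of_real b) x)"
      using True norm_triangle_ineq by (simp add: \<Phi>_def left_def flip: norm_mult)
    also have "\<dots> \<le> cmod A * exp (- Re z * b / sqrt \<gamma>\<^sub>1) + cmod B * 1"
      by (intro add_mono mult_left_mono 1 2) auto
    finally show ?thesis by simp
  next
    case False
    have "Re z2 * x + Re (- z2 * of_real b) = Re z2 * (x - b)" by (simp add: algebra_simps)
    also have "\<dots> \<le> 0" using neg False by (simp add: mult_nonpos_nonneg)
    finally have 1: "cmod (exp_aff z2 (- z2 * of_real b) x) \<le> 1" by (simp only: e) simp
    have "Re (- z2) * x + Re (z2 * of_real (2 * a - b)) = Re z2 * (2 * a - b - x)"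
      by (simp add: algebra_simps)
    also have "\<dots> \<le> 0" using neg b x by (intro mult_nonpos_nonneg) auto
    finally have 2: "cmod (exp_aff (- z2) (z2 * of_real (2 * a - b)) x) \<le> 1" by (simp only: e) simp
    have "cmod (\<Phi> x) \<le> 1 + 1"
      using False norm_triangle_mono[OF 1 2] by (simp add: \<Phi>_def right_def)
    also have "\<dots> \<le> cmod A * exp (- Re z * b / sqrt \<gamma>\<^sub>1) + cmod B + 2" by simp
    finally show ?thesis .
  qed
qed

text \<open>The hypotheses that \<open>moment_identity\<close> puts on a test function, for the real and imaginary parts
  of \<open>\<Phi>\<close>.\<close>

lemma component_admissible:
  assumes r: "bounded_linear (r :: complex \<Rightarrow> real)"
  shows "(\<lambda>x. r (\<Phi> x)) \<in> H1 a" "(\<lambda>x. r (P x)) \<in> L2 a"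
    "weak_deriv a (\<lambda>x. r (\<Phi> x)) (\<lambda>x. r (P x))"
    "((\<lambda>x. r (K x)) has_real_derivative r (z\<^sup>2 * \<Phi> x)) (at x)"
    "continuous_on UNIV (\<lambda>x. r (z\<^sup>2 * \<Phi> x))"
    "r (K x) = conductivity b \<gamma>\<^sub>1 \<gamma>\<^sub>2 x * r (P x)"
proof -
  have rc: "continuous_on S (\<lambda>x. r (f x))" if "continuous_on S f" for S and f :: "real \<Rightarrow> complex"
    using bounded_linear.continuous_on[OF r that] .
  have rd: "((\<lambda>x. r (f x)) has_real_derivative r f') (at x)"
    if "(f has_vector_derivative f') (at x)" for f f' x
    using bounded_linear.has_vector_derivative[OF r that] by (simp add: has_real_derivative_iff_has_vector_derivative)
  have eq: "(\<lambda>x. r (\<Phi> x)) = (\<lambda>x. if x < b then r (left x) else r (right x))"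
    "(\<lambda>x. r (P x)) = (\<lambda>x. if x < b then r (left' x) else r (right' x))"
    by (auto simp: \<Phi>_def P_def)
  have a: "0 < a" using b by simp
  note H = piecewise_H1[OF rd[OF left_deriv] rc[OF left_continuous(2)] rd[OF right_deriv]
      rc[OF right_continuous(2)] _ a, of b, folded eq]
  show "(\<lambda>x. r (\<Phi> x)) \<in> H1 a" "(\<lambda>x. r (P x)) \<in> L2 a"
    "weak_deriv a (\<lambda>x. r (\<Phi> x)) (\<lambda>x. r (P x))"
    using H by (simp_all add: left_eq_right_at_interface)
  show "((\<lambda>x. r (K x)) has_real_derivative r (z\<^sup>2 * \<Phi> x)) (at x)" by (rule rd[OF K_deriv])
  show "continuous_on UNIV (\<lambda>x. r (z\<^sup>2 * \<Phi> x))" by (intro rc continuous_intros \<Phi>_continuous)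
  show "r (K x) = conductivity b \<gamma>\<^sub>1 \<gamma>\<^sub>2 x * r (P x)"
    using linear_cmul[OF bounded_linear.linear[OF r], of "conductivity b \<gamma>\<^sub>1 \<gamma>\<^sub>2 x" "P x"]
    by (simp add: K_eq scaleR_conv_of_real)
qed

end

section \<open>The indicator function in terms of boundary data\<close>

lemma exp_decay_deriv:
  "((\<lambda>t. exp (- s * complex_of_real t)) has_vector_derivative - s * exp (- s * of_real t)) (at t)"
proof -
  have "((\<lambda>w. exp (- s * w)) has_field_derivative - s * exp (- s * of_real t)) (at (of_real t))"
    by (auto intro!: derivative_eq_intros)
  from has_vector_derivative_real_field[OF this] show ?thesis by simp
qed

lemma exp_decay_continuous: "continuous_on S (\<lambda>t. exp (- s * complex_of_real t))"
  by (intro continuous_intros)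

context transmission
begin

text \<open>Green's formula for \<open>w\<close> and \<open>\<Phi>\<close>. Since \<open>(\<gamma> \<Phi>')' = z\<^sup>2 \<Phi>\<close> and the weight \<open>exp (- z\<^sup>2 t)\<close> has
  derivative \<open>- z\<^sup>2 exp (- z\<^sup>2 t)\<close>, the two volume terms cancel; besides the boundary
  terms only the final time contributes.\<close>

lemma transformed_identity:
  assumes T: "0 < T"
    and sol: "heat_solution a b \<gamma>\<^sub>1 \<gamma>\<^sub>2 T u u\<^sub>x\<^sub>0 u\<^sub>x\<^sub>a"
    and U: "\<And>t. t \<in> {0..T} \<Longrightarrow> U t \<in> L2 a"
    and Ucont: "\<And>s. s \<in> {0..T} \<Longrightarrow> ((\<lambda>t. L2_norm a (\<lambda>x. U t x - U s x)) \<longlongrightarrow> 0) (at s within {0..T})"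
    and Uae: "AE t in leb T. AE x in leb a. U t x = u t x"
    and U0: "AE x in leb a. U 0 x = 0"
  shows "of_real \<gamma>\<^sub>2 * \<Phi> a * truncated_laplace T z u\<^sub>x\<^sub>a - of_real \<gamma>\<^sub>1 * \<Phi> 0 * truncated_laplace T z u\<^sub>x\<^sub>0
      + K 0 * truncated_laplace T z (\<lambda>t. u t 0)
    = (of_real (LINT x|leb a. U T x * Re (\<Phi> x)) + \<i> * of_real (LINT x|leb a. U T x * Im (\<Phi> x)))
      * exp (- z\<^sup>2 * of_real T)"
proof -
  have a: "0 < a" using b by simp
  define W where "W t = exp (- z\<^sup>2 * complex_of_real t)" for t
  define HR where "HR t = (LINT x|leb a. U t x * Re (\<Phi> x))" for t
  define HI where "HI t = (LINT x|leb a. U t x * Im (\<Phi> x))" for t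
  define mR where "mR = (LINT t|leb T. of_real (HR t) * W t)"
  define mI where "mI = (LINT t|leb T. of_real (HI t) * W t)"
  define p where "p = Re (z\<^sup>2)"
  define q where "q = Im (z\<^sup>2)"
  have Wd: "(W has_vector_derivative - z\<^sup>2 * W t) (at t)" for t
    unfolding W_def[abs_def] by (rule exp_decay_deriv)
  have Wc: "continuous_on S W" for S unfolding W_def[abs_def] by (rule exp_decay_continuous)
  have W'c: "continuous_on UNIV (\<lambda>t. - z\<^sup>2 * W t)" by (intro continuous_intros Wc)
  have lap: "truncated_laplace T z g = (LINT t|leb T. of_real (g t) * W t)" for g
    by (simp add: truncated_laplace_def W_def mult.commute)
  have Hc: "continuous_on {0..T} HR" "continuous_on {0..T} HI"
    unfolding HR_def[abs_def] HI_def[abs_def]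
    by (intro pairing_continuous[OF a U Ucont] continuous_intros \<Phi>_continuous; assumption)+
  have Hi: "integrable (leb T) (\<lambda>t. of_real (HR t) * W t)" "integrable (leb T) (\<lambda>t. of_real (HI t) * W t)"
    by (intro integrable_leb_continuous continuous_intros Hc Wc)+
  have pz: "z\<^sup>2 = of_real p + \<i> * of_real q" by (simp add: p_def q_def complex_eq_iff)
  have H: "(LINT x|leb a. U t x * Re (z\<^sup>2 * \<Phi> x)) = p * HR t - q * HI t"
    "(LINT x|leb a. U t x * Im (z\<^sup>2 * \<Phi> x)) = p * HI t + q * HR t" if t: "t \<in> space (leb T)" for t
  proof -
    have Ut: "integrable (leb a) (U t)" using U[of t] t by (auto intro: L2_integrable)
    have i: "integrable (leb a) (\<lambda>x. U t x * Re (\<Phi> x))" "integrable (leb a) (\<lambda>x. U t x * Im (\<Phi> x))"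
      by (intro integrable_mult_continuous Ut continuous_intros \<Phi>_continuous)+
    have "(LINT x|leb a. U t x * Re (z\<^sup>2 * \<Phi> x))
        = (LINT x|leb a. p * (U t x * Re (\<Phi> x)) - q * (U t x * Im (\<Phi> x)))"
      by (rule Bochner_Integration.integral_cong) (simp_all add: p_def q_def algebra_simps)
    also have "\<dots> = p * HR t - q * HI t" using i by (simp add: HR_def HI_def)
    finally show "(LINT x|leb a. U t x * Re (z\<^sup>2 * \<Phi> x)) = p * HR t - q * HI t" .
    have "(LINT x|leb a. U t x * Im (z\<^sup>2 * \<Phi> x))
        = (LINT x|leb a. p * (U t x * Im (\<Phi> x)) + q * (U t x * Re (\<Phi> x)))"
      by (rule Bochner_Integration.integral_cong) (simp_all add: p_def q_def algebra_simps)
    also have "\<dots> = p * HI t + q * HR t" using i by (simp add: HR_def HI_def)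
    finally show "(LINT x|leb a. U t x * Im (z\<^sup>2 * \<Phi> x)) = p * HI t + q * HR t" .
  qed
  have t1: "(LINT t|leb T. of_real (LINT x|leb a. U t x * Re (\<Phi> x)) * (- z\<^sup>2 * W t)) = - z\<^sup>2 * mR"
  proof -
    have "(LINT t|leb T. of_real (HR t) * (- z\<^sup>2 * W t)) = (LINT t|leb T. - z\<^sup>2 * (of_real (HR t) * W t))"
      by (rule Bochner_Integration.integral_cong) (simp_all add: algebra_simps)
    also have "\<dots> = - z\<^sup>2 * mR" unfolding mR_def by (rule integral_mult_right_zero)
    finally show ?thesis unfolding HR_def .
  qed
  have t2: "(LINT t|leb T. of_real (LINT x|leb a. U t x * Im (\<Phi> x)) * (- z\<^sup>2 * W t)) = - z\<^sup>2 * mI"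
  proof -
    have "(LINT t|leb T. of_real (HI t) * (- z\<^sup>2 * W t)) = (LINT t|leb T. - z\<^sup>2 * (of_real (HI t) * W t))"
      by (rule Bochner_Integration.integral_cong) (simp_all add: algebra_simps)
    also have "\<dots> = - z\<^sup>2 * mI" unfolding mI_def by (rule integral_mult_right_zero)
    finally show ?thesis unfolding HI_def .
  qed
  have t3: "(LINT t|leb T. of_real (LINT x|leb a. U t x * Re (z\<^sup>2 * \<Phi> x)) * W t)
      = of_real p * mR - of_real q * mI"
  proof -
    have "(LINT t|leb T. of_real (LINT x|leb a. U t x * Re (z\<^sup>2 * \<Phi> x)) * W t)
      = (LINT t|leb T. of_real p * (of_real (HR t) * W t) - of_real q * (of_real (HI t) * W t))"
      by (rule Bochner_Integration.integral_cong) (simp_all only: H, simp_all add: algebra_simps)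
    also have "\<dots> = of_real p * mR - of_real q * mI" using Hi by (simp add: mR_def mI_def)
    finally show ?thesis .
  qed
  have t4: "(LINT t|leb T. of_real (LINT x|leb a. U t x * Im (z\<^sup>2 * \<Phi> x)) * W t)
      = of_real p * mI + of_real q * mR"
  proof -
    have "(LINT t|leb T. of_real (LINT x|leb a. U t x * Im (z\<^sup>2 * \<Phi> x)) * W t)
      = (LINT t|leb T. of_real p * (of_real (HI t) * W t) + of_real q * (of_real (HR t) * W t))"
      by (rule Bochner_Integration.integral_cong) (simp_all only: H, simp_all add: algebra_simps)
    also have "\<dots> = of_real p * mI + of_real q * mR" using Hi by (simp add: mR_def mI_def)
    finally show ?thesis .
  qed
  note R = component_admissible[OF bounded_linear_Re]
  note I = component_admissible[OF bounded_linear_Im]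
  note idR = moment_identity[OF a T sol U Ucont Uae U0 R(1,2,3,6,4,5) Wd W'c,
      unfolded t1 t3, folded lap HR_def, unfolded flux_at_a]
  note idI = moment_identity[OF a T sol U Ucont Uae U0 I(1,2,3,6,4,5) Wd W'c,
      unfolded t2 t4, folded lap HI_def, unfolded flux_at_a]
  have split: "\<Phi> a = of_real (Re (\<Phi> a)) + \<i> * of_real (Im (\<Phi> a))"
    "\<Phi> 0 = of_real (Re (\<Phi> 0)) + \<i> * of_real (Im (\<Phi> 0))"
    "K 0 = of_real (Re (K 0)) + \<i> * of_real (Im (K 0))"
    by (simp_all add: complex_eq_iff)
  define X Y Z where "X = truncated_laplace T z u\<^sub>x\<^sub>a" and "Y = truncated_laplace T z u\<^sub>x\<^sub>0"
    and "Z = truncated_laplace T z (\<lambda>t. u t 0)"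
  have eR: "- z\<^sup>2 * mR + (of_real p * mR - of_real q * mI) + of_real \<gamma>\<^sub>2 * of_real (Re (\<Phi> a)) * X
      - of_real \<gamma>\<^sub>1 * of_real (Re (\<Phi> 0)) * Y + of_real (Re (K 0)) * Z = of_real (HR T) * W T"
    using idR unfolding X_def Y_def Z_def by simp
  have eI: "- z\<^sup>2 * mI + (of_real p * mI + of_real q * mR) + of_real \<gamma>\<^sub>2 * of_real (Im (\<Phi> a)) * X
      - of_real \<gamma>\<^sub>1 * of_real (Im (\<Phi> 0)) * Y + of_real (Im (K 0)) * Z = of_real (HI T) * W T"
    using idI unfolding X_def Y_def Z_def by simp
  have alg: "g2 * (ra + \<i> * ia) * X - g1 * (r0 + \<i> * i0) * Y + (rk + \<i> * ik) * Z
      = (- z\<^sup>2 * mR + (of_real p * mR - of_real q * mI) + g2 * ra * X - g1 * r0 * Y + rk * Z)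
        + \<i> * (- z\<^sup>2 * mI + (of_real p * mI + of_real q * mR) + g2 * ia * X - g1 * i0 * Y + ik * Z)"
    for g1 g2 ra ia r0 i0 rk ik
    by (simp add: pz algebra_simps)
  have "of_real \<gamma>\<^sub>2 * \<Phi> a * X - of_real \<gamma>\<^sub>1 * \<Phi> 0 * Y + K 0 * Z
      = of_real (HR T) * W T + \<i> * (of_real (HI T) * W T)"
    by (rule alg[of "of_real \<gamma>\<^sub>2" "of_real (Re (\<Phi> a))" "of_real (Im (\<Phi> a))" "of_real \<gamma>\<^sub>1" "of_real (Re (\<Phi> 0))" "of_real (Im (\<Phi> 0))"
        "of_real (Re (K 0))" "of_real (Im (K 0))", folded split, unfolded eR eI])
  also have "\<dots> = (of_real (HR T) + \<i> * of_real (HI T)) * W T" by (simp add: distrib_right)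
  finally have "of_real \<gamma>\<^sub>2 * \<Phi> a * X - of_real \<gamma>\<^sub>1 * \<Phi> 0 * Y + K 0 * Z
      = (of_real (HR T) + \<i> * of_real (HI T)) * W T" .
  then show ?thesis unfolding X_def Y_def Z_def HR_def HI_def W_def .
qed

lemma indicator_split:
  assumes sol: "heat_solution a b \<gamma>\<^sub>1 \<gamma>\<^sub>2 T u u\<^sub>x\<^sub>0 u\<^sub>x\<^sub>a" and z: "z = z_param c \<tau>"
  shows "indicator_fun \<gamma>\<^sub>1 T u u\<^sub>x\<^sub>0 c \<tau>
    = of_real \<gamma>\<^sub>1 * (truncated_laplace T z u\<^sub>x\<^sub>0 - z1 * truncated_laplace T z (\<lambda>t. u t 0))"
proof -
  have uB: "u \<in> L2_Bochner T (H1 a) (H1_norm a)" and x0: "u\<^sub>x\<^sub>0 \<in> L2 T"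
    using sol by (auto simp: heat_solution_def)
  have a: "0 < a" using b by simp
  define W where "W t = exp (- z\<^sup>2 * complex_of_real t)" for t
  have Wc: "continuous_on S W" for S unfolding W_def[abs_def] by (rule exp_decay_continuous)
  have lap: "truncated_laplace T z g = (LINT t|leb T. g t *\<^sub>R W t)" for g
    by (simp add: truncated_laplace_def W_def mult.commute scaleR_conv_of_real)
  have vd: "vector_derivative (\<lambda>x. v_fun \<gamma>\<^sub>1 z x t) (at 0) = z1 * W t" for t
  proof -
    have "v_fun \<gamma>\<^sub>1 z x t = W t * exp_aff z1 0 x" for x
      by (simp add: v_fun_def exp_aff_def z1_def W_def mult.commute)
    then have "((\<lambda>x. v_fun \<gamma>\<^sub>1 z x t) has_vector_derivative W t * (z1 * exp_aff z1 0 0)) (at 0)"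
      using has_vector_derivative_mult_right[OF exp_aff_deriv[of z1 0 0], of "W t"] by simp
    then show ?thesis by (simp add: vector_derivative_at exp_aff_def mult.commute)
  qed
  have i: "integrable (leb T) (\<lambda>t. u t 0 *\<^sub>R W t)" "integrable (leb T) (\<lambda>t. u\<^sub>x\<^sub>0 t *\<^sub>R W t)"
    using integrable_trace[OF uB a, of 0] L2_integrable[OF x0]
    by (auto intro: integrable_scaleR_continuous Wc)
  have "indicator_fun \<gamma>\<^sub>1 T u u\<^sub>x\<^sub>0 c \<tau>
    = (LINT t|leb T. of_real \<gamma>\<^sub>1 * (u\<^sub>x\<^sub>0 t *\<^sub>R W t) - of_real \<gamma>\<^sub>1 * z1 * (u t 0 *\<^sub>R W t))"
    unfolding indicator_fun_def z[symmetric] vd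
    by (rule Bochner_Integration.integral_cong)
       (simp_all add: v_fun_def W_def scaleR_conv_of_real)
  also have "\<dots> = of_real \<gamma>\<^sub>1 * (truncated_laplace T z u\<^sub>x\<^sub>0 - z1 * truncated_laplace T z (\<lambda>t. u t 0))"
    using Bochner_Integration.integral_diff[OF integrable_mult_right[OF i(2)] integrable_mult_right[OF i(1)],
        of "of_real \<gamma>\<^sub>1" "of_real \<gamma>\<^sub>1 * z1"]
    by (simp only: lap integral_mult_right_zero right_diff_distrib mult.assoc)
  finally show ?thesis .
qed

text \<open>Green's formula with \<open>w(0)\<close> eliminated in favour of the indicator function; the remainder \<open>R\<close>
  is the final-time term, estimated by means of \<open>\<Phi>_bound\<close> and the \<open>L\<^sup>1\<close> norm of the final state.\<close>

lemma indicator_identity: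
  assumes T: "0 < T"
    and sol: "heat_solution a b \<gamma>\<^sub>1 \<gamma>\<^sub>2 T u u\<^sub>x\<^sub>0 u\<^sub>x\<^sub>a"
    and U: "\<And>t. t \<in> {0..T} \<Longrightarrow> U t \<in> L2 a"
    and Ucont: "\<And>s. s \<in> {0..T} \<Longrightarrow> ((\<lambda>t. L2_norm a (\<lambda>x. U t x - U s x)) \<longlongrightarrow> 0) (at s within {0..T})"
    and Uae: "AE t in leb T. AE x in leb a. U t x = u t x"
    and U0: "AE x in leb a. U 0 x = 0"
    and z: "z = z_param c \<tau>" and zre: "Re z \<le> 0"
  obtains R where
    "cmod R \<le> 2 * (LINT x|leb a. \<bar>U T x\<bar>) * exp (- Re (z\<^sup>2) * T)
        * (cmod A * exp (- Re z * b / sqrt \<gamma>\<^sub>1) + cmod B + 2)"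
    "(A - B * exp (2 * (z1 * of_real b))) * indicator_fun \<gamma>\<^sub>1 T u u\<^sub>x\<^sub>0 c \<tau>
      = - 2 * of_real \<gamma>\<^sub>1 * B * exp (2 * (z1 * of_real b)) * truncated_laplace T z u\<^sub>x\<^sub>0
        + 2 * of_real \<gamma>\<^sub>2 * exp (z2 * of_real (a - b)) * exp (z1 * of_real b) * truncated_laplace T z u\<^sub>x\<^sub>a
        - R * exp (z1 * of_real b)"
proof
  define C where "C = cmod A * exp (- Re z * b / sqrt \<gamma>\<^sub>1) + cmod B + 2"
  define N where "N = (LINT x|leb a. \<bar>U T x\<bar>)"
  define H where "H = of_real (LINT x|leb a. U T x * Re (\<Phi> x)) + \<i> * of_real (LINT x|leb a. U T x * Im (\<Phi> x))"
  define E where "E = exp (z1 * of_real b)"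
  have UT: "integrable (leb a) (U T)" using U[of T] T by (auto intro: L2_integrable)
  have part: "\<bar>LINT x|leb a. U T x * r x\<bar> \<le> N * C"
    if r: "continuous_on {0..a} r" "\<And>x. 0 \<le> x \<Longrightarrow> x \<le> a \<Longrightarrow> \<bar>r x\<bar> \<le> C" for r
  proof -
    have "norm (LINT x|leb a. U T x * r x) \<le> (LINT x|leb a. norm (U T x * r x))"
      by (rule integral_norm_bound)
    also have "\<dots> \<le> (LINT x|leb a. \<bar>U T x\<bar> * C)"
    proof (rule integral_mono)
      show "integrable (leb a) (\<lambda>x. norm (U T x * r x))"
        using integrable_mult_continuous[OF UT r(1)] by (rule integrable_norm)
      show "integrable (leb a) (\<lambda>x. \<bar>U T x\<bar> * C)" using UT by simp
      show "norm (U T x * r x) \<le> \<bar>U T x\<bar> * C" if "x \<in> space (leb a)" for x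
        using r(2)[of x] that by (simp add: abs_mult mult_left_mono)
    qed
    also have "\<dots> = N * C" by (simp add: N_def)
    finally show ?thesis by simp
  qed
  have \<Phi>C: "cmod (\<Phi> x) \<le> C" if "0 \<le> x" "x \<le> a" for x
    unfolding C_def by (rule \<Phi>_bound[OF zre that])
  have "\<bar>LINT x|leb a. U T x * Re (\<Phi> x)\<bar> \<le> N * C" "\<bar>LINT x|leb a. U T x * Im (\<Phi> x)\<bar> \<le> N * C"
    by (intro part continuous_intros \<Phi>_continuous order_trans[OF abs_Re_le_cmod \<Phi>C]
        order_trans[OF abs_Im_le_cmod \<Phi>C]; assumption)+
  then have "cmod H \<le> 2 * N * C"
    unfolding H_def by (intro norm_triangle_le) (simp add: norm_mult)
  then show "cmod (H * exp (- z\<^sup>2 * of_real T)) \<le> 2 * (LINT x|leb a. \<bar>U T x\<bar>) * exp (- Re (z\<^sup>2) * T)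
        * (cmod A * exp (- Re z * b / sqrt \<gamma>\<^sub>1) + cmod B + 2)"
    unfolding C_def[symmetric] N_def[symmetric]
    using mult_right_mono[of "cmod H" "2 * N * C" "exp (- Re (z\<^sup>2) * T)"]
    by (simp add: norm_mult mult_ac)
  have id: "of_real \<gamma>\<^sub>2 * \<Phi> a * truncated_laplace T z u\<^sub>x\<^sub>a - of_real \<gamma>\<^sub>1 * \<Phi> 0 * truncated_laplace T z u\<^sub>x\<^sub>0
      + K 0 * truncated_laplace T z (\<lambda>t. u t 0) = H * exp (- z\<^sup>2 * of_real T)"
    unfolding H_def by (rule transformed_identity[OF T sol U Ucont Uae U0])
  define X Y Z where "X = truncated_laplace T z u\<^sub>x\<^sub>a" and "Y = truncated_laplace T z u\<^sub>x\<^sub>0"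
    and "Z = truncated_laplace T z (\<lambda>t. u t 0)"
  have E: "exp (- (z1 * of_real b)) * E = 1" by (simp add: E_def flip: exp_add)
  have E2: "exp (2 * (z1 * of_real b)) = E * E" by (simp only: E_def mult_2 exp_add)
  have R: "H * exp (- z\<^sup>2 * of_real T) = of_real \<gamma>\<^sub>2 * (2 * exp (z2 * of_real (a - b))) * X
     - of_real \<gamma>\<^sub>1 * (A * exp (- (z1 * of_real b)) + B * E) * Y
     + of_real \<gamma>\<^sub>1 * z1 * (A * exp (- (z1 * of_real b)) - B * E) * Z"
    using id unfolding X_def Y_def Z_def \<Phi>_a \<Phi>_0 flux_at_0 E_def by simp
  \<comment> \<open>Multiply Green's formula by \<open>E\<close>; here \<open>F\<close> stands for \<open>exp (- z\<^sub>1 b)\<close>.\<close>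
  have alg: "(A - B * (E * E)) * (g1 * (Y - z1 * Z)) =
      - 2 * g1 * B * (E * E) * Y + 2 * g2 * q * E * X
      - (g2 * (2 * q) * X - g1 * (A * F + B * E) * Y + g1 * z1 * (A * F - B * E) * Z) * E"
    if "F * E = 1" for F g1 g2 q
  proof -
    have FE: "E * (F * y) = y" for y using that by (simp add: mult.assoc[symmetric] mult.commute[of E])
    show ?thesis by (simp add: algebra_simps FE)
  qed
  show "(A - B * exp (2 * (z1 * of_real b))) * indicator_fun \<gamma>\<^sub>1 T u u\<^sub>x\<^sub>0 c \<tau>
      = - 2 * of_real \<gamma>\<^sub>1 * B * exp (2 * (z1 * of_real b)) * truncated_laplace T z u\<^sub>x\<^sub>0
        + 2 * of_real \<gamma>\<^sub>2 * exp (z2 * of_real (a - b)) * exp (z1 * of_real b) * truncated_laplace T z u\<^sub>x\<^sub>a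
        - H * exp (- z\<^sup>2 * of_real T) * exp (z1 * of_real b)"
    unfolding indicator_split[OF sol z] R X_def[symmetric] Y_def[symmetric] Z_def[symmetric] E2
      E_def[symmetric] by (rule alg[OF E])
qed

end

lemma z_param_Re: "Re (z_param c \<tau>) = - (c * \<tau>)"
  by (simp add: z_param_def)

lemma z_param_square_Re:
  assumes "0 < c" "1 / c\<^sup>2 < \<tau>"
  shows "Re ((z_param c \<tau>)\<^sup>2) = \<tau>"
proof -
  have \<tau>: "0 < \<tau>" using assms by (meson less_trans zero_less_divide_1_iff zero_less_power)
  then have "1 / (c\<^sup>2 * \<tau>) \<le> 1" using assms by (simp add: field_simps)
  then have "(sqrt (1 - 1 / (c\<^sup>2 * \<tau>)))\<^sup>2 = 1 - 1 / (c\<^sup>2 * \<tau>)" by simp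
  moreover have "Re ((z_param c \<tau>)\<^sup>2) = (c * \<tau>)\<^sup>2 * (1 - (sqrt (1 - 1 / (c\<^sup>2 * \<tau>)))\<^sup>2)"
    by (simp add: z_param_def power2_eq_square algebra_simps)
  ultimately show ?thesis using \<tau> assms by (simp add: power2_eq_square)
qed

section \<open>Asymptotics of the indicator function\<close>

lemma tendsto_exp_decay_squared:
  fixes s :: real
  assumes "0 < s"
  shows "((\<lambda>\<tau>. exp (- (s * \<tau>)) * exp (- (s * \<tau>))) \<longlongrightarrow> 0) at_top"
  using assms by real_asymp

lemma truncated_laplace_bound:
  assumes g: "integrable (leb T) g" and z: "0 \<le> Re (z\<^sup>2)"
  shows "cmod (truncated_laplace T z g) \<le> (LINT t|leb T. \<bar>g t\<bar>)"
proof -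
  have i: "integrable (leb T) (\<lambda>t. exp (- z\<^sup>2 * of_real t) * of_real (g t))"
    using integrable_scaleR_continuous[OF g exp_decay_continuous[of _ "z\<^sup>2"]]
    by (simp add: scaleR_conv_of_real mult.commute)
  have "cmod (truncated_laplace T z g) \<le> (LINT t|leb T. cmod (exp (- z\<^sup>2 * of_real t) * of_real (g t)))"
    unfolding truncated_laplace_def by (rule integral_norm_bound)
  also have "\<dots> \<le> (LINT t|leb T. \<bar>g t\<bar>)"
  proof (rule integral_mono)
    show "integrable (leb T) (\<lambda>t. cmod (exp (- z\<^sup>2 * of_real t) * of_real (g t)))"
      using i by (rule integrable_norm)
    show "integrable (leb T) (\<lambda>t. \<bar>g t\<bar>)" using g by simp
    fix t assume "t \<in> space (leb T)"
    then have "cmod (exp (- z\<^sup>2 * of_real t)) \<le> 1" using z by simp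
    then show "cmod (exp (- z\<^sup>2 * of_real t) * of_real (g t)) \<le> \<bar>g t\<bar>"
      by (simp only: norm_mult norm_of_real) (simp add: mult_left_le_one_le)
  qed
  finally show ?thesis .
qed

text \<open>Factors that converge to a nonzero limit, or that lie between a positive multiple of a power and a
  constant, do not affect the exponential rate.\<close>

lemma log_quotient_tendsto:
  fixes J Q E Y :: "real \<Rightarrow> complex"
  assumes J: "\<forall>\<^sub>F \<tau> in at_top. J \<tau> = Q \<tau> * E \<tau> * Y \<tau>"
    and Q: "(Q \<longlongrightarrow> L) at_top" "L \<noteq> 0"
    and E: "\<And>\<tau>. cmod (E \<tau>) = exp (- (s * \<tau>))"
    and C: "0 < C" "\<forall>\<^sub>F \<tau> in at_top. C * \<tau> powr \<mu> \<le> cmod (Y \<tau>)"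
    and N: "\<forall>\<^sub>F \<tau> in at_top. cmod (Y \<tau>) \<le> N"
  shows "((\<lambda>\<tau>. ln (cmod (J \<tau>)) / \<tau>) \<longlongrightarrow> - s) at_top"
proof -
  have Ypos: "\<forall>\<^sub>F \<tau> in at_top. 0 < cmod (Y \<tau>)"
    using C(2) eventually_gt_at_top[of 0]
  proof eventually_elim
    case (elim \<tau>)
    then have "0 < C * \<tau> powr \<mu>" using C(1) by simp
    with elim show ?case by linarith
  qed
  have Qne: "\<forall>\<^sub>F \<tau> in at_top. Q \<tau> \<noteq> 0"
    by (rule tendsto_imp_eventually_ne[OF Q])
  have 1: "((\<lambda>\<tau>. ln (cmod (Q \<tau>)) / \<tau>) \<longlongrightarrow> 0) at_top"
  proof (rule real_tendsto_divide_at_top)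
    show "((\<lambda>\<tau>. ln (cmod (Q \<tau>))) \<longlongrightarrow> ln (cmod L)) at_top"
      using Q by (intro tendsto_intros) auto
  qed (rule filterlim_ident)
  have 2: "((\<lambda>\<tau>. ln (cmod (Y \<tau>)) / \<tau>) \<longlongrightarrow> 0) at_top"
  proof (rule tendsto_sandwich)
    show "\<forall>\<^sub>F \<tau> in at_top. (ln C + \<mu> * ln \<tau>) / \<tau> \<le> ln (cmod (Y \<tau>)) / \<tau>"
      using C(2) Ypos eventually_gt_at_top[of 0]
    proof eventually_elim
      case (elim \<tau>)
      have "ln C + \<mu> * ln \<tau> = ln (C * \<tau> powr \<mu>)"
        using C(1) elim by (simp add: ln_mult ln_powr)
      also have "\<dots> \<le> ln (cmod (Y \<tau>))" using elim C(1) by (subst ln_le_cancel_iff) auto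
      finally show ?case using elim by (intro divide_right_mono) auto
    qed
    show "\<forall>\<^sub>F \<tau> in at_top. ln (cmod (Y \<tau>)) / \<tau> \<le> ln N / \<tau>"
      using N Ypos eventually_gt_at_top[of 0]
    proof eventually_elim
      case (elim \<tau>)
      then have "ln (cmod (Y \<tau>)) \<le> ln N" by (intro ln_mono) auto
      then show ?case using elim by (intro divide_right_mono) auto
    qed
    show "((\<lambda>\<tau>. (ln C + \<mu> * ln \<tau>) / \<tau>) \<longlongrightarrow> 0) at_top" by real_asymp
    show "((\<lambda>\<tau>. ln N / \<tau>) \<longlongrightarrow> 0) at_top" by real_asymp
  qed
  have "((\<lambda>\<tau>. ln (cmod (Q \<tau>)) / \<tau> + (- s) + ln (cmod (Y \<tau>)) / \<tau>) \<longlongrightarrow> 0 + (- s) + 0) at_top"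
    by (intro tendsto_add 1 2 tendsto_const)
  then have "((\<lambda>\<tau>. ln (cmod (Q \<tau>)) / \<tau> + (- s) + ln (cmod (Y \<tau>)) / \<tau>) \<longlongrightarrow> - s) at_top" by simp
  then show ?thesis
  proof (rule Lim_transform_eventually)
    show "\<forall>\<^sub>F \<tau> in at_top. ln (cmod (Q \<tau>)) / \<tau> + (- s) + ln (cmod (Y \<tau>)) / \<tau> = ln (cmod (J \<tau>)) / \<tau>"
      using J Ypos Qne eventually_gt_at_top[of 0]
    proof eventually_elim
      case (elim \<tau>)
      have "ln (cmod (J \<tau>)) = ln (cmod (Q \<tau>)) + (- (s * \<tau>)) + ln (cmod (Y \<tau>))"
        using elim by (simp add: norm_mult E ln_mult)
      then show ?case using elim by (simp add: add_divide_distrib diff_divide_distrib)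
    qed
  qed
qed

theorem theorem2p1:
  fixes a b T \<gamma>\<^sub>1 \<gamma>\<^sub>2 M c :: real
    and u :: "real \<Rightarrow> real \<Rightarrow> real" and u\<^sub>x\<^sub>0 u\<^sub>x\<^sub>a :: "real \<Rightarrow> real"
  assumes "0 < b" and "b < a" and "0 < T"
    and "0 < \<gamma>\<^sub>1" and "0 < \<gamma>\<^sub>2" and "\<gamma>\<^sub>1 \<noteq> \<gamma>\<^sub>2"
    and "heat_solution a b \<gamma>\<^sub>1 \<gamma>\<^sub>2 T u u\<^sub>x\<^sub>0 u\<^sub>x\<^sub>a"
    and "0 < M" and "2 * b / sqrt \<gamma>\<^sub>1 \<le> M"
    and "0 < c" and "M * c < T"
    and "((\<lambda>\<tau>. cmod (truncated_laplace T (z_param c \<tau>) u\<^sub>x\<^sub>a / truncated_laplace T (z_param c \<tau>) u\<^sub>x\<^sub>0)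
            * exp (c * \<tau> * (b / sqrt \<gamma>\<^sub>1 - (a - b) / sqrt \<gamma>\<^sub>2))) \<longlongrightarrow> 0) at_top"
    and "\<exists>C \<tau>\<^sub>0 \<mu>. 0 < C \<and> 0 < \<tau>\<^sub>0 \<and>
           (\<forall>\<tau>. \<tau>\<^sub>0 < \<tau> \<and> 1 / c\<^sup>2 < \<tau> \<longrightarrow>
              C * \<tau> powr \<mu> \<le> cmod (truncated_laplace T (z_param c \<tau>) u\<^sub>x\<^sub>0))"
  shows "((\<lambda>\<tau>. ln (cmod (indicator_fun \<gamma>\<^sub>1 T u u\<^sub>x\<^sub>0 c \<tau>)) / \<tau>) \<longlongrightarrow> - 2 * (c * b / sqrt \<gamma>\<^sub>1)) at_top"
proof -
  note sol = \<open>heat_solution a b \<gamma>\<^sub>1 \<gamma>\<^sub>2 T u u\<^sub>x\<^sub>0 u\<^sub>x\<^sub>a\<close>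
  note pos = \<open>0 < b\<close> \<open>b < a\<close> \<open>0 < T\<close> \<open>0 < \<gamma>\<^sub>1\<close> \<open>0 < \<gamma>\<^sub>2\<close> \<open>0 < c\<close>
  obtain U where U: "\<And>t. t \<in> {0..T} \<Longrightarrow> U t \<in> L2 a"
    and Ucont: "\<And>s. s \<in> {0..T} \<Longrightarrow> ((\<lambda>t. L2_norm a (\<lambda>x. U t x - U s x)) \<longlongrightarrow> 0) (at s within {0..T})"
    and Uae: "AE t in leb T. AE x in leb a. U t x = u t x"
    and U0: "AE x in leb a. U 0 x = 0"
    using sol unfolding heat_solution_def zero_initial_value_def by blast
  obtain C \<tau>\<^sub>0 \<mu> where C: "0 < C"
    and low: "\<And>\<tau>. \<tau>\<^sub>0 < \<tau> \<Longrightarrow> 1 / c\<^sup>2 < \<tau> \<Longrightarrow>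
      C * \<tau> powr \<mu> \<le> cmod (truncated_laplace T (z_param c \<tau>) u\<^sub>x\<^sub>0)"
    using assms(13) by blast
  define \<kappa> where "\<kappa> = sqrt \<gamma>\<^sub>1"
  define \<nu> where "\<nu> = sqrt \<gamma>\<^sub>2"
  have \<kappa>: "0 < \<kappa>" and \<nu>: "0 < \<nu>" and \<kappa>\<nu>: "\<kappa> \<noteq> \<nu>"
    using pos \<open>\<gamma>\<^sub>1 \<noteq> \<gamma>\<^sub>2\<close> by (auto simp: \<kappa>_def \<nu>_def)
  define Z1 where "Z1 \<tau> = z_param c \<tau> / of_real \<kappa> * of_real b" for \<tau>
  define Z2 where "Z2 \<tau> = z_param c \<tau> / of_real \<nu> * of_real (a - b)" for \<tau>
  define Am where "Am \<tau> = outer_amp \<gamma>\<^sub>1 \<gamma>\<^sub>2 (exp (2 * Z2 \<tau>))" for \<tau>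
  define Bm where "Bm \<tau> = inner_amp \<gamma>\<^sub>1 \<gamma>\<^sub>2 (exp (2 * Z2 \<tau>))" for \<tau>
  define X where "X \<tau> = truncated_laplace T (z_param c \<tau>) u\<^sub>x\<^sub>a" for \<tau>
  define Y where "Y \<tau> = truncated_laplace T (z_param c \<tau>) u\<^sub>x\<^sub>0" for \<tau>
  define J where "J \<tau> = indicator_fun \<gamma>\<^sub>1 T u u\<^sub>x\<^sub>0 c \<tau>" for \<tau>
  define N where "N = 2 * (LINT x|leb a. \<bar>U T x\<bar>)"
  \<comment> \<open>The excess of the decay \<open>exp (- \<tau> T)\<close> of the final-time term over \<open>exp (- 2 c b \<tau> / \<kappa>)\<close>, the
    modulus of \<open>exp (2 z\<^sub>1 b)\<close>.\<close>
  define \<delta> where "\<delta> = T - 2 * c * b / \<kappa>"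
  have N: "0 \<le> N" by (simp add: N_def)
  have "2 * b / \<kappa> * c \<le> M * c" using assms(9) pos by (intro mult_right_mono) (auto simp: \<kappa>_def)
  then have \<delta>: "0 < \<delta>" using assms(11) by (simp add: \<delta>_def mult_ac)
  have nZ1: "cmod (exp (Z1 \<tau>)) = exp (- (c * b / \<kappa> * \<tau>))" for \<tau>
    by (simp add: Z1_def z_param_Re mult_ac)
  have nZ2: "cmod (exp (Z2 \<tau>)) = exp (- (c * (a - b) / \<nu> * \<tau>))" for \<tau>
    by (simp add: Z2_def z_param_Re mult_ac)
  have sq: "exp (2 * w) = exp w * exp w" for w :: complex by (simp only: mult_2 exp_add)
  have lim1: "((\<lambda>\<tau>. exp (2 * Z1 \<tau>)) \<longlongrightarrow> 0) at_top"
  proof (rule tendsto_norm_zero_cancel)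
    have "0 < c * b / \<kappa>" using pos \<kappa> by simp
    then show "((\<lambda>\<tau>. cmod (exp (2 * Z1 \<tau>))) \<longlongrightarrow> 0) at_top"
      unfolding sq norm_mult nZ1 by (rule tendsto_exp_decay_squared)
  qed
  have lim2: "((\<lambda>\<tau>. exp (2 * Z2 \<tau>)) \<longlongrightarrow> 0) at_top"
  proof (rule tendsto_norm_zero_cancel)
    have "0 < c * (a - b) / \<nu>" using pos \<nu> by simp
    then show "((\<lambda>\<tau>. cmod (exp (2 * Z2 \<tau>))) \<longlongrightarrow> 0) at_top"
      unfolding sq norm_mult nZ2 by (rule tendsto_exp_decay_squared)
  qed
  define A0 where "A0 = outer_amp \<gamma>\<^sub>1 \<gamma>\<^sub>2 0"
  define B0 where "B0 = inner_amp \<gamma>\<^sub>1 \<gamma>\<^sub>2 0"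
  have Am: "(Am \<longlongrightarrow> A0) at_top"
    unfolding Am_def A0_def outer_amp_def by (intro tendsto_intros lim2) simp
  have Bm: "(Bm \<longlongrightarrow> B0) at_top"
    unfolding Bm_def B0_def inner_amp_def by (intro tendsto_intros lim2) simp
  have A0: "A0 \<noteq> 0"
  proof -
    have "A0 = of_real ((1 + \<nu> / \<kappa>) / 2)" by (simp add: A0_def outer_amp_def \<kappa>_def \<nu>_def)
    moreover have "0 < (1 + \<nu> / \<kappa>) / 2" using \<kappa> \<nu> by (simp add: add_pos_pos)
    ultimately show ?thesis by (metis of_real_eq_0_iff less_irrefl)
  qed
  \<comment> \<open>Here \<open>\<gamma>\<^sub>1 \<noteq> \<gamma>\<^sub>2\<close> enters: without a jump nothing is reflected.\<close>
  have B0: "B0 \<noteq> 0"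
  proof -
    have "B0 = of_real ((1 - \<nu> / \<kappa>) / 2)" by (simp add: B0_def inner_amp_def \<kappa>_def \<nu>_def)
    moreover have "(1 - \<nu> / \<kappa>) / 2 \<noteq> 0" using \<kappa> \<kappa>\<nu> by simp
    ultimately show ?thesis by (metis of_real_eq_0_iff)
  qed
  define D where "D \<tau> = Am \<tau> - Bm \<tau> * exp (2 * Z1 \<tau>)" for \<tau>
  have D: "(D \<longlongrightarrow> A0) at_top"
    unfolding D_def using tendsto_diff[OF Am tendsto_mult[OF Bm lim1]] by simp
  have "\<forall>\<tau>. \<exists>R. 1 / c\<^sup>2 < \<tau> \<longrightarrow>
      cmod R \<le> N * exp (- \<tau> * T) * (cmod (Am \<tau>) * exp (c * b / \<kappa> * \<tau>) + cmod (Bm \<tau>) + 2) \<and>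
      D \<tau> * J \<tau> = - 2 * of_real \<gamma>\<^sub>1 * Bm \<tau> * exp (2 * Z1 \<tau>) * Y \<tau>
        + 2 * of_real \<gamma>\<^sub>2 * exp (Z2 \<tau>) * exp (Z1 \<tau>) * X \<tau> - R * exp (Z1 \<tau>)"
  proof
    fix \<tau>
    show "\<exists>R. 1 / c\<^sup>2 < \<tau> \<longrightarrow>
      cmod R \<le> N * exp (- \<tau> * T) * (cmod (Am \<tau>) * exp (c * b / \<kappa> * \<tau>) + cmod (Bm \<tau>) + 2) \<and>
      D \<tau> * J \<tau> = - 2 * of_real \<gamma>\<^sub>1 * Bm \<tau> * exp (2 * Z1 \<tau>) * Y \<tau>
        + 2 * of_real \<gamma>\<^sub>2 * exp (Z2 \<tau>) * exp (Z1 \<tau>) * X \<tau> - R * exp (Z1 \<tau>)"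
    proof (cases "1 / c\<^sup>2 < \<tau>")
      case True
      interpret transmission a b \<gamma>\<^sub>1 \<gamma>\<^sub>2 "z_param c \<tau>"
        by unfold_locales (use pos in auto)
      have \<tau>: "0 < \<tau>" using True pos by (meson less_trans zero_less_divide_1_iff zero_less_power)
      have re: "Re (z_param c \<tau>) \<le> 0" using pos \<tau> by (simp add: z_param_Re)
      have e: "z1 * of_real b = Z1 \<tau>" "z2 * of_real (a - b) = Z2 \<tau>" "A = Am \<tau>" "B = Bm \<tau>"
        by (simp_all add: z1_def z2_def Z1_def Z2_def A_def B_def Am_def Bm_def \<epsilon>_def \<kappa>_def \<nu>_def mult.assoc)
      have e': "- Re (z_param c \<tau>) * b / sqrt \<gamma>\<^sub>1 = c * b / \<kappa> * \<tau>" by (simp add: z_param_Re \<kappa>_def mult_ac)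
      obtain R where "cmod R \<le> 2 * (LINT x|leb a. \<bar>U T x\<bar>) * exp (- Re ((z_param c \<tau>)\<^sup>2) * T)
          * (cmod A * exp (- Re (z_param c \<tau>) * b / sqrt \<gamma>\<^sub>1) + cmod B + 2)"
        "(A - B * exp (2 * (z1 * of_real b))) * indicator_fun \<gamma>\<^sub>1 T u u\<^sub>x\<^sub>0 c \<tau>
          = - 2 * of_real \<gamma>\<^sub>1 * B * exp (2 * (z1 * of_real b)) * truncated_laplace T (z_param c \<tau>) u\<^sub>x\<^sub>0
            + 2 * of_real \<gamma>\<^sub>2 * exp (z2 * of_real (a - b)) * exp (z1 * of_real b)
                * truncated_laplace T (z_param c \<tau>) u\<^sub>x\<^sub>a
            - R * exp (z1 * of_real b)"
        by (rule indicator_identity[OF \<open>0 < T\<close> sol U Ucont Uae U0 refl re])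
      then show ?thesis
        unfolding e e' z_param_square_Re[OF \<open>0 < c\<close> True] N_def[symmetric] X_def[symmetric]
          Y_def[symmetric] J_def[symmetric] D_def[symmetric] by blast
    qed simp
  qed
  then obtain R where RB: "\<And>\<tau>. 1 / c\<^sup>2 < \<tau> \<Longrightarrow>
      cmod (R \<tau>) \<le> N * exp (- \<tau> * T) * (cmod (Am \<tau>) * exp (c * b / \<kappa> * \<tau>) + cmod (Bm \<tau>) + 2)"
    and Rid: "\<And>\<tau>. 1 / c\<^sup>2 < \<tau> \<Longrightarrow>
      D \<tau> * J \<tau> = - 2 * of_real \<gamma>\<^sub>1 * Bm \<tau> * exp (2 * Z1 \<tau>) * Y \<tau>
        + 2 * of_real \<gamma>\<^sub>2 * exp (Z2 \<tau>) * exp (Z1 \<tau>) * X \<tau> - R \<tau> * exp (Z1 \<tau>)"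
    by metis
  have ev: "\<forall>\<^sub>F \<tau> in at_top. 0 < \<tau> \<and> 1 / c\<^sup>2 < \<tau> \<and> C * \<tau> powr \<mu> \<le> cmod (Y \<tau>)"
    using eventually_gt_at_top[of 0] eventually_gt_at_top[of "1 / c\<^sup>2"] eventually_gt_at_top[of \<tau>\<^sub>0]
    by eventually_elim (auto simp: Y_def intro: low)
  \<comment> \<open>The indicator function divided by \<open>exp (2 z\<^sub>1 b) w'(0)\<close>.\<close>
  define Q where "Q \<tau> = (- 2 * of_real \<gamma>\<^sub>1 * Bm \<tau> + 2 * of_real \<gamma>\<^sub>2 * (exp (Z2 \<tau>) / exp (Z1 \<tau>) * (X \<tau> / Y \<tau>))
      - R \<tau> / (exp (Z1 \<tau>) * Y \<tau>)) / D \<tau>" for \<tau>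
  have limX: "((\<lambda>\<tau>. exp (Z2 \<tau>) / exp (Z1 \<tau>) * (X \<tau> / Y \<tau>)) \<longlongrightarrow> 0) at_top"
  proof (rule tendsto_norm_zero_cancel)
    have "cmod (exp (Z2 \<tau>) / exp (Z1 \<tau>) * (X \<tau> / Y \<tau>))
        = cmod (X \<tau> / Y \<tau>) * exp (c * \<tau> * (b / sqrt \<gamma>\<^sub>1 - (a - b) / sqrt \<gamma>\<^sub>2))" for \<tau>
    proof -
      have "cmod (exp (Z2 \<tau>) / exp (Z1 \<tau>)) = exp (c * \<tau> * (b / sqrt \<gamma>\<^sub>1 - (a - b) / sqrt \<gamma>\<^sub>2))"
        unfolding norm_divide nZ1 nZ2
        by (simp add: \<kappa>_def \<nu>_def algebra_simps flip: exp_diff)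
      then show ?thesis by (simp only: norm_mult mult.commute)
    qed
    then show "((\<lambda>\<tau>. cmod (exp (Z2 \<tau>) / exp (Z1 \<tau>) * (X \<tau> / Y \<tau>))) \<longlongrightarrow> 0) at_top"
      using assms(12) by (simp only: X_def Y_def)
  qed
  have limR: "((\<lambda>\<tau>. R \<tau> / (exp (Z1 \<tau>) * Y \<tau>)) \<longlongrightarrow> 0) at_top"
  proof (rule Lim_null_comparison)
    show "\<forall>\<^sub>F \<tau> in at_top. norm (R \<tau> / (exp (Z1 \<tau>) * Y \<tau>))
        \<le> N * (cmod (Am \<tau>) + cmod (Bm \<tau>) + 2) / C * (exp (- \<delta> * \<tau>) * \<tau> powr (- \<mu>))"
      using ev
    proof eventually_elim
      case (elim \<tau>)
      define g where "g = exp (c * b / \<kappa> * \<tau>)"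
      have g: "1 \<le> g" using elim pos \<kappa> by (simp add: g_def)
      have Cp: "0 < C * \<tau> powr \<mu>" using elim C by simp
      have "cmod (R \<tau>) \<le> N * exp (- \<tau> * T) * (cmod (Am \<tau>) * g + cmod (Bm \<tau>) + 2)"
        using RB[of \<tau>] elim by (simp add: g_def)
      also have "\<dots> \<le> N * exp (- \<tau> * T) * (cmod (Am \<tau>) * g + cmod (Bm \<tau>) * g + 2 * g)"
        using g N by (intro mult_left_mono add_mono) (auto simp: mult_left_mono[of 1 g, simplified])
      also have "\<dots> = N * (cmod (Am \<tau>) + cmod (Bm \<tau>) + 2) * (exp (- \<tau> * T) * g)"
        by (simp add: algebra_simps)
      finally have 1: "cmod (R \<tau>) \<le> N * (cmod (Am \<tau>) + cmod (Bm \<tau>) + 2) * (exp (- \<tau> * T) * g)" .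
      have "exp (- \<tau> * T) * g * g = exp (- \<delta> * \<tau>)"
        by (simp add: g_def \<delta>_def algebra_simps flip: exp_add)
      moreover have "cmod (exp (Z1 \<tau>)) = 1 / g" by (simp only: nZ1 g_def exp_minus inverse_eq_divide)
      ultimately have "norm (R \<tau> / (exp (Z1 \<tau>) * Y \<tau>)) = cmod (R \<tau>) * g / cmod (Y \<tau>)"
        by (simp add: norm_divide norm_mult)
      also have "\<dots> \<le> N * (cmod (Am \<tau>) + cmod (Bm \<tau>) + 2) * (exp (- \<tau> * T) * g) * g / (C * \<tau> powr \<mu>)"
        using 1 elim Cp g N by (intro frac_le mult_right_mono) (auto intro!: mult_nonneg_nonneg)
      also have "\<dots> = N * (cmod (Am \<tau>) + cmod (Bm \<tau>) + 2) / C * ((exp (- \<tau> * T) * g * g) * \<tau> powr (- \<mu>))"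
        by (simp add: powr_minus divide_inverse mult_ac)
      also have "exp (- \<tau> * T) * g * g = exp (- \<delta> * \<tau>)" by fact
      finally show ?case .
    qed
    have "((\<lambda>\<tau>. exp (- \<delta> * \<tau>) * \<tau> powr (- \<mu>)) \<longlongrightarrow> 0) at_top"
      using \<delta> by real_asymp
    moreover have "((\<lambda>\<tau>. N * (cmod (Am \<tau>) + cmod (Bm \<tau>) + 2) / C) \<longlongrightarrow> N * (cmod A0 + cmod B0 + 2) / C) at_top"
      using C by (intro tendsto_intros Am Bm) auto
    ultimately show "((\<lambda>\<tau>. N * (cmod (Am \<tau>) + cmod (Bm \<tau>) + 2) / C * (exp (- \<delta> * \<tau>) * \<tau> powr (- \<mu>)))
        \<longlongrightarrow> 0) at_top"
      using tendsto_mult by fastforce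
  qed
  have limQ: "(Q \<longlongrightarrow> (- 2 * of_real \<gamma>\<^sub>1 * B0 + 2 * of_real \<gamma>\<^sub>2 * 0 - 0) / A0) at_top"
    unfolding Q_def by (intro tendsto_intros Bm limX limR D A0)
  have "((\<lambda>\<tau>. ln (cmod (J \<tau>)) / \<tau>) \<longlongrightarrow> - (2 * (c * b / \<kappa>))) at_top"
  proof (rule log_quotient_tendsto[OF _ limQ _ _ C])
    show "\<forall>\<^sub>F \<tau> in at_top. J \<tau> = Q \<tau> * exp (2 * Z1 \<tau>) * Y \<tau>"
      using ev tendsto_imp_eventually_ne[OF D A0]
    proof eventually_elim
      case (elim \<tau>)
      have "0 < C * \<tau> powr \<mu>" using elim C by simp
      then have Y: "Y \<tau> \<noteq> 0" using elim by auto
      have alg: "(- 2 * g1 * \<beta> + 2 * g2 * (e2 / e1 * (x / y)) - r / (e1 * y)) * (e1 * e1) * y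
          = - 2 * g1 * \<beta> * (e1 * e1) * y + 2 * g2 * e2 * e1 * x - r * e1"
        if "e1 \<noteq> 0" "y \<noteq> 0" for g1 g2 \<beta> e1 e2 x y r :: complex
        using that by (simp add: field_simps)
      have "D \<tau> * (Q \<tau> * exp (2 * Z1 \<tau>) * Y \<tau>) = D \<tau> * J \<tau>"
        using Rid[of \<tau>] elim alg[OF exp_not_eq_zero Y] by (simp add: Q_def sq)
      then show ?case using elim by simp
    qed
    show "(- 2 * of_real \<gamma>\<^sub>1 * B0 + 2 * of_real \<gamma>\<^sub>2 * 0 - 0) / A0 \<noteq> 0"
      using pos A0 B0 by simp
    show "cmod (exp (2 * Z1 \<tau>)) = exp (- (2 * (c * b / \<kappa>) * \<tau>))" for \<tau>
      unfolding sq norm_mult nZ1 by (simp flip: exp_add)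
    show "\<forall>\<^sub>F \<tau> in at_top. C * \<tau> powr \<mu> \<le> cmod (Y \<tau>)"
      using ev by eventually_elim simp
    show "\<forall>\<^sub>F \<tau> in at_top. cmod (Y \<tau>) \<le> (LINT t|leb T. \<bar>u\<^sub>x\<^sub>0 t\<bar>)"
      using ev
    proof eventually_elim
      case (elim \<tau>)
      have "integrable (leb T) u\<^sub>x\<^sub>0" using sol by (auto simp: heat_solution_def intro: L2_integrable)
      then show ?case
        unfolding Y_def using elim z_param_square_Re[OF \<open>0 < c\<close>] by (intro truncated_laplace_bound) auto
    qed
  qed
  then show ?thesis by (simp add: J_def \<kappa>_def)
qed

end
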